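(* Let $H$ be a Hilbert space with inner product $(\cdot,\cdot)$ and norm $\|\cdot\|$, let $D\subset H$ be a dense linear subspace, let $P,A:D\to H$ be symmetric, positive definite linear operators, and let $F:D\to H$ be a (nonlinear) gradient operator with potential $G:D\to\mathbb{R}$. Suppose that there exist $\alpha>0$ and $R_0\ge 0$ such that $$(F(v),v)\ \ge\ 2(1+2\alpha)G(v)-2R_0\qquad \text{for all } v\in D,$$ and that there exists $a_0>0$ such that $$(Av,v)\ \ge\ a_0\,(Pv,v)\qquad \text{for all } v\in D.$$ Let $u_0,u_1\in D$ satisfy $$\frac{(u_0,Pu_1)}{(u_0,Pu_0)}>0$$ and $$\frac12(u_0,Au_0)+\frac12(Pu_1,u_1)-G(u_0)+\frac{R_0}{1+2\alpha}\ <\ \frac12\,\frac{(u_0,Pu_1)^2}{(u_0,Pu_0)}.$$ Let $u$ be the strong solution, considered on its maximal interval of existence, of the Cauchy problem $$Pu_{tt}+Au=F(u),\qquad u(0)=u_0,\quad u_t(0)=u_1.$$ Then there exists $t_1>0$ (finite) such that $$\lim_{t\to t_1^-}(Pu(t),u(t))=+\infty .$$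
   Context: $F:D\to H$ being a gradient operator with potential $G:D\to\mathbb{R}$ means that $F$ is the gradient of $G$; in particular $\frac{d}{dt}G(u(t))=(F(u(t)),u_t(t))$ along solutions $u$, so that the energy $\frac12(Pu_t,u_t)+\frac12(Au,u)-G(u)$ is conserved. $F$ is assumed continuously differentiable. A solution $u$ is a vector-function with domain $[0,T)$ and range in $D$. It is a strong solution if all terms of the equation $Pu_{tt}+Au=F(u)$ are elements of $L^2(0,T;H)$ and $u(\cdot),u_t(\cdot)\in C(0,T;H)$. Local solvability of the Cauchy problem is presupposed.
   Formalization: Local solvability is taken to include that a strong solution with these data on a finite interval along which (Pu,u) stays bounded can be continued; without this u may stop existing, e.g. by leaving D, while (Pu,u) stays bounded, and the claim fails. *)

theory Defs
  imports "HOL-Analysis.Analysis"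
begin

text \<open>
  \<open>H\<close> is a type of class \<open>{real_inner, complete_space}\<close>. Operators on the subspace \<open>D\<close> are total
  functions \<open>H \<Rightarrow> H\<close> whose values outside \<open>D\<close> are irrelevant.
\<close>

definition linear_operator_on :: "'a::real_vector set \<Rightarrow> ('a \<Rightarrow> 'a) \<Rightarrow> bool" where
  "linear_operator_on D L \<longleftrightarrow>
     (\<forall>v\<in>D. \<forall>w\<in>D. L (v + w) = L v + L w) \<and> (\<forall>c. \<forall>v\<in>D. L (c *\<^sub>R v) = c *\<^sub>R L v)"

definition symmetric_on :: "'a::real_inner set \<Rightarrow> ('a \<Rightarrow> 'a) \<Rightarrow> bool" where
  "symmetric_on D L \<longleftrightarrow> (\<forall>v\<in>D. \<forall>w\<in>D. inner (L v) w = inner v (L w))"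

definition positive_definite_on :: "'a::real_inner set \<Rightarrow> ('a \<Rightarrow> 'a) \<Rightarrow> bool" where
  "positive_definite_on D L \<longleftrightarrow> (\<forall>v\<in>D. v \<noteq> 0 \<longrightarrow> inner (L v) v > 0)"

text \<open>
  \<open>D\<close> carries no topology of its own, so differentiability on \<open>D\<close> is meant in the sense of
  Gateaux: the directional derivatives in directions of \<open>D\<close> exist, depend linearly on the
  direction, and depend continuously on the base point along lines in \<open>D\<close>. This is implied by
  continuous Frechet differentiability with respect to any norm on \<open>D\<close> finer than that of \<open>H\<close>.
\<close>

definition continuously_differentiable_on_subspace ::
    "'a::real_normed_vector set \<Rightarrow> ('a \<Rightarrow> 'a) \<Rightarrow> bool" where
  "continuously_differentiable_on_subspace D F \<longleftrightarrow>
     (\<exists>F'. \<forall>v\<in>D. linear_operator_on D (F' v) \<and>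
        (\<forall>h\<in>D. ((\<lambda>s. F (v + s *\<^sub>R h)) has_vector_derivative F' v h) (at 0)) \<and>
        (\<forall>h\<in>D. \<forall>k\<in>D. continuous_on UNIV (\<lambda>s. F' (v + s *\<^sub>R k) h)))"

definition is_gradient_on :: "'a::real_inner set \<Rightarrow> ('a \<Rightarrow> 'a) \<Rightarrow> ('a \<Rightarrow> real) \<Rightarrow> bool" where
  "is_gradient_on D F G \<longleftrightarrow>
     (\<forall>v\<in>D. \<forall>h\<in>D. ((\<lambda>s. G (v + s *\<^sub>R h)) has_real_derivative inner (F v) h) (at 0))"

text \<open>
  \<open>L\<^sup>2(0,T;H)\<close>. The relation \<open>measurable_on\<close> is strong measurability (a.e. limit of continuous
  functions), so \<open>H\<close> need not be separable.
\<close>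

definition L2_on :: "real \<Rightarrow> (real \<Rightarrow> 'a::real_normed_vector) \<Rightarrow> bool" where
  "L2_on T f \<longleftrightarrow> f measurable_on {0<..<T} \<and>
     (\<lambda>t. (norm (f t))\<^sup>2) absolutely_integrable_on {0<..<T}"

text \<open>
  A strong solution \<open>u\<close> of \<open>P u_tt + A u = F(u)\<close> on \<open>[0,T)\<close> with its derivatives \<open>u' = u_t\<close> and
  \<open>u'' = u_tt\<close>. The first is a classical derivative; since \<open>P u_tt\<close> is only an \<open>L\<^sup>2\<close> function,
  \<open>u''\<close> is determined up to null sets, as the density of \<open>u'\<close>.
  All values of \<open>u'\<close> lie in \<open>D\<close>, so that the energy term \<open>(P u_t, u_t)\<close> makes sense.
\<close>

definition strong_solution_derivs ::
    "'a::{real_inner, complete_space} set \<Rightarrow> ('a \<Rightarrow> 'a) \<Rightarrow> ('a \<Rightarrow> 'a) \<Rightarrow> ('a \<Rightarrow> 'a) \<Rightarrow> real \<Rightarrow>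
     (real \<Rightarrow> 'a) \<Rightarrow> (real \<Rightarrow> 'a) \<Rightarrow> (real \<Rightarrow> 'a) \<Rightarrow> bool" where
  "strong_solution_derivs D P A F T u u' u'' \<longleftrightarrow>
     (\<forall>t\<in>{0..<T}. u t \<in> D \<and> u' t \<in> D) \<and>
     continuous_on {0..<T} u \<and> continuous_on {0..<T} u' \<and>
     (\<forall>t\<in>{0..<T}. (u has_vector_derivative u' t) (at t within {0..<T})) \<and>
     (\<forall>t\<in>{0..<T}. (u'' has_integral (u' t - u' 0)) {0..t}) \<and>
     (AE t in lebesgue_on {0<..<T}. u'' t \<in> D \<and> P (u'' t) + A (u t) = F (u t)) \<and>
     L2_on T (\<lambda>t. P (u'' t)) \<and> L2_on T (\<lambda>t. A (u t)) \<and> L2_on T (\<lambda>t. F (u t))"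

definition strong_solution ::
    "'a::{real_inner, complete_space} set \<Rightarrow> ('a \<Rightarrow> 'a) \<Rightarrow> ('a \<Rightarrow> 'a) \<Rightarrow> ('a \<Rightarrow> 'a) \<Rightarrow>
     'a \<Rightarrow> 'a \<Rightarrow> real \<Rightarrow> (real \<Rightarrow> 'a) \<Rightarrow> bool" where
  "strong_solution D P A F u0 u1 T u \<longleftrightarrow>
     (\<exists>u' u''. strong_solution_derivs D P A F T u u' u'' \<and> u 0 = u0 \<and> u' 0 = u1)"

text \<open>
  The chain rule \<open>d/dt G(u(t)) = (F(u(t)), u_t(t))\<close> along strong solutions, in integrated form
  (which follows from the pointwise one, and is what it amounts to when \<open>F(u)\<close> is merely in
  \<open>L\<^sup>2\<close> in time). It is part of the meaning of a gradient operator here, and does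
  not follow from the directional derivatives alone.
\<close>

definition potential_chain_rule ::
    "'a::{real_inner, complete_space} set \<Rightarrow> ('a \<Rightarrow> 'a) \<Rightarrow> ('a \<Rightarrow> 'a) \<Rightarrow> ('a \<Rightarrow> 'a) \<Rightarrow>
     ('a \<Rightarrow> real) \<Rightarrow> bool" where
  "potential_chain_rule D P A F G \<longleftrightarrow>
     (\<forall>T u u' u''. strong_solution_derivs D P A F T u u' u'' \<longrightarrow>
        (\<forall>t\<in>{0..<T}. ((\<lambda>s. inner (F (u s)) (u' s)) has_integral (G (u t) - G (u 0))) {0..t}))"

text \<open>
  A strong solution on a possibly infinite interval \<open>[0,T)\<close> is one that is strong on every
  \<open>[0,S)\<close> with \<open>S < T\<close>; the \<open>L\<^sup>2\<close> norms may blow up at \<open>T\<close>.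
\<close>

definition strong_solution_upto ::
    "'a::{real_inner, complete_space} set \<Rightarrow> ('a \<Rightarrow> 'a) \<Rightarrow> ('a \<Rightarrow> 'a) \<Rightarrow> ('a \<Rightarrow> 'a) \<Rightarrow>
     'a \<Rightarrow> 'a \<Rightarrow> ereal \<Rightarrow> (real \<Rightarrow> 'a) \<Rightarrow> bool" where
  "strong_solution_upto D P A F u0 u1 T u \<longleftrightarrow>
     0 < T \<and> (\<forall>S>0. ereal S < T \<longrightarrow> strong_solution D P A F u0 u1 S u)"

definition extendable ::
    "'a::{real_inner, complete_space} set \<Rightarrow> ('a \<Rightarrow> 'a) \<Rightarrow> ('a \<Rightarrow> 'a) \<Rightarrow> ('a \<Rightarrow> 'a) \<Rightarrow>
     'a \<Rightarrow> 'a \<Rightarrow> ereal \<Rightarrow> (real \<Rightarrow> 'a) \<Rightarrow> bool" where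
  "extendable D P A F u0 u1 T u \<longleftrightarrow>
     (\<exists>S w. T < ereal S \<and> strong_solution D P A F u0 u1 S w \<and>
        (\<forall>t\<ge>0. ereal t < T \<longrightarrow> w t = u t))"

definition maximal_strong_solution ::
    "'a::{real_inner, complete_space} set \<Rightarrow> ('a \<Rightarrow> 'a) \<Rightarrow> ('a \<Rightarrow> 'a) \<Rightarrow> ('a \<Rightarrow> 'a) \<Rightarrow>
     'a \<Rightarrow> 'a \<Rightarrow> ereal \<Rightarrow> (real \<Rightarrow> 'a) \<Rightarrow> bool" where
  "maximal_strong_solution D P A F u0 u1 T u \<longleftrightarrow>
     strong_solution_upto D P A F u0 u1 T u \<and> \<not> extendable D P A F u0 u1 T u"

text \<open>
  The presupposed solvability of the Cauchy problem, in the form in which a blow-up theorem for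
  \<open>(P u, u)\<close> needs it: the solution can be continued as long as \<open>(P u, u)\<close> stays bounded.
  Without it a solution may cease to exist in finite time for an unrelated reason, e.g. by
  leaving the subspace \<open>D\<close>, which need not be closed in any sense.
\<close>

definition local_solvability ::
    "'a::{real_inner, complete_space} set \<Rightarrow> ('a \<Rightarrow> 'a) \<Rightarrow> ('a \<Rightarrow> 'a) \<Rightarrow> ('a \<Rightarrow> 'a) \<Rightarrow>
     'a \<Rightarrow> 'a \<Rightarrow> bool" where
  "local_solvability D P A F u0 u1 \<longleftrightarrow>
     (\<exists>T>0. \<exists>u. strong_solution D P A F u0 u1 T u) \<and>
     (\<forall>T u. strong_solution_upto D P A F u0 u1 (ereal T) u \<and>
        (\<exists>M. \<forall>t\<in>{0..<T}. inner (P (u t)) (u t) \<le> M) \<longrightarrow>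
        extendable D P A F u0 u1 (ereal T) u)"

end

theory Submission
  imports Defs
begin

text \<open>
  The proof is Levine's concavity method. Along the solution let
  \<open>\<Psi> = (P u, u)\<close>, \<open>\<Phi> = (P u, u_t)\<close>, \<open>p = (P u_t, u_t)\<close>, so that \<open>\<Psi>' = 2 \<Phi>\<close> and
  \<open>\<Phi>' = p + (F(u), u) - (A u, u)\<close>. The structure condition on \<open>F\<close> bounds \<open>(F(u), u)\<close> below by \<open>G(u)\<close>,
  and conservation of energy expresses \<open>G(u)\<close> by \<open>p\<close> and \<open>(A u, u)\<close>; since \<open>(A u, u) \<ge> 0\<close>, what
  remains is \<open>\<Phi>' \<ge> 2 (1 + \<alpha>) p - 2 (1 + 2 \<alpha>) K\<close>, where \<open>K\<close> is the positive part of
  \<open>E(0) + R0 / (1 + 2 \<alpha>)\<close> and \<open>E\<close> is the energy. By the Cauchy-Schwarz inequality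
  \<open>p \<ge> \<Phi>\<^sup>2 / \<Psi>\<close>, and with this the quantity \<open>(\<Phi>\<^sup>2 / \<Psi> - 2 K) * \<Psi> powr -(1 + 2 \<alpha>)\<close>, called \<open>levine\<close> below,
  cannot decrease as long as \<open>\<Phi> > 0\<close>. By the hypotheses on the initial data, \<open>\<Phi>\<close> and the value
  \<open>\<zeta>\<close> of this quantity at time \<open>0\<close> are positive. Hence \<open>\<Phi>\<close> stays positive,
  \<open>\<Phi> \<ge> sqrt \<zeta> * \<Psi> powr (1 + \<alpha>)\<close>, and the positive function \<open>\<Psi> powr -\<alpha>\<close> decreases at least at the
  rate \<open>2 \<alpha> sqrt \<zeta>\<close> (\<open>concavity_blow_up_time\<close>). So the solution has a finite life time. A maximal
  solution that ends in finite time has unbounded \<open>\<Psi>\<close>, and \<open>\<Psi>\<close> increases; therefore it tends to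
  infinity at the end of the life time.

  The remaining work is to justify the differentiations for strong solutions. Here \<open>P u_tt\<close> and
  \<open>A u\<close> are only square integrable in time, \<open>P\<close> and \<open>A\<close> may be unbounded, and \<open>\<Phi>\<close>
  need not be differentiable. Everything is therefore done with
  integral identities for scalar functions, obtained by testing against elements of the dense
  subspace \<open>D\<close> and moving the symmetric operator to the test element. For \<open>P\<close> this gives a product
  rule (\<open>product_rule\<close>), since \<open>P u_t\<close> turns out to be absolutely continuous with density
  \<open>P u_tt\<close>. For \<open>A\<close> no such density exists, as \<open>A u_t\<close> may fail to be integrable; there \<open>(A u, u)\<close> is
  differentiated by averaging difference quotients over time (\<open>form_increment\<close>). The growth
  estimate for \<open>\<Phi>\<close> is then used in integrated form, by comparing \<open>\<Phi>\<close> near each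
  point with a differentiable function (\<open>nondecreasing_if_supported\<close>).
\<close>

section \<open>Increments of real functions\<close>

text \<open>
  Subdividing \<open>[a, b]\<close> finely, the increments of \<open>q\<close> add up to at most \<open>\<epsilon>\<close> times the increment of \<open>N\<close>
  for every \<open>\<epsilon>\<close>. The use is to prove integral identities for functions that are not
  differentiable: \<open>N\<close> is the indefinite integral of a dominating function.
\<close>

lemma constant_if_increments_negligible:
  fixes q N :: "real \<Rightarrow> real"
  assumes "a \<le> b"
    and flat: "\<And>\<epsilon>. \<epsilon> > 0 \<Longrightarrow> \<exists>\<delta>>0. \<forall>s t. a \<le> s \<and> s \<le> t \<and> t \<le> b \<and> t - s < \<delta> \<longrightarrow>
                 \<bar>q t - q s\<bar> \<le> \<epsilon> * (N t - N s)"
  shows "q b = q a"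
proof -
  have bound: "\<bar>q b - q a\<bar> \<le> \<epsilon> * (N b - N a)" if eps: "\<epsilon> > 0" for \<epsilon>
  proof -
    obtain \<delta> where "\<delta> > 0" and \<delta>: "\<And>s t. a \<le> s \<Longrightarrow> s \<le> t \<Longrightarrow> t \<le> b \<Longrightarrow> t - s < \<delta> \<Longrightarrow>
        \<bar>q t - q s\<bar> \<le> \<epsilon> * (N t - N s)"
      using flat[OF eps] by blast
    have "a \<le> a \<and> b \<le> b \<longrightarrow> \<bar>q b - q a\<bar> \<le> \<epsilon> * (N b - N a)"
      using \<open>a \<le> b\<close>
    proof (induction rule: Bolzano[where P="\<lambda>s t. a \<le> s \<and> t \<le> b \<longrightarrow> \<bar>q t - q s\<bar> \<le> \<epsilon> * (N t - N s)"])
      case (trans r s t)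
      show ?case
      proof
        assume *: "a \<le> r \<and> t \<le> b"
        have "\<bar>q s - q r\<bar> \<le> \<epsilon> * (N s - N r)" "\<bar>q t - q s\<bar> \<le> \<epsilon> * (N t - N s)"
          using trans * by auto
        then show "\<bar>q t - q r\<bar> \<le> \<epsilon> * (N t - N r)"
          by (simp add: right_diff_distrib)
      qed
    next
      case (local x)
      show ?case
        using \<open>\<delta> > 0\<close> \<delta> by (intro exI[of _ \<delta>]) auto
    qed
    then show ?thesis by simp
  qed
  \<comment> \<open>The bound holds for every \<open>\<epsilon> > 0\<close>; let \<open>\<epsilon>\<close> tend to \<open>0\<close>.\<close>
  have "((\<lambda>\<epsilon>. \<epsilon> * (N b - N a)) \<longlongrightarrow> 0 * (N b - N a)) (at_right 0)"
    by (intro tendsto_intros)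
  then have "\<bar>q b - q a\<bar> \<le> 0"
    by (intro tendsto_lowerbound[of _ 0 "at_right 0"])
       (auto simp: eventually_at_right_less bound intro: eventually_mono[OF eventually_at_right_less])
  then show ?thesis by simp
qed

text \<open>
  At each point \<open>x\<close> the graph of \<open>Z\<close> touches that of a differentiable function \<open>W\<close> whose slope at \<open>x\<close> is
  nonnegative, and \<open>Z\<close> lies above \<open>W\<close> to the right and below it to the left. So near \<open>x\<close> the
  increments of \<open>Z\<close> across \<open>x\<close> are at least those of \<open>W\<close>, which are at least \<open>-\<epsilon>\<close> times the
  length; subdivision carries this over to \<open>[a, b]\<close>. The function \<open>Z\<close> itself need not be
  differentiable.
\<close>

lemma nondecreasing_if_supported:
  fixes Z :: "real \<Rightarrow> real"
  assumes "a \<le> b"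
    and support: "\<And>x. a \<le> x \<Longrightarrow> x \<le> b \<Longrightarrow> \<exists>W D d. 0 \<le> D \<and> 0 < d \<and>
           (W has_real_derivative D) (at x within {a..b}) \<and> W x = Z x \<and>
           (\<forall>y\<in>{a..b}. x \<le> y \<and> y < x + d \<longrightarrow> W y \<le> Z y) \<and>
           (\<forall>y\<in>{a..b}. x - d < y \<and> y \<le> x \<longrightarrow> Z y \<le> W y)"
  shows "Z a \<le> Z b"
proof -
  have bound: "Z b - Z a \<ge> - \<epsilon> * (b - a)" if "\<epsilon> > 0" for \<epsilon>
  proof -
    have "a \<le> a \<and> b \<le> b \<longrightarrow> Z b - Z a \<ge> - \<epsilon> * (b - a)"
      using \<open>a \<le> b\<close>
    proof (induction rule: Bolzano[where P="\<lambda>s t. a \<le> s \<and> t \<le> b \<longrightarrow> Z t - Z s \<ge> - \<epsilon> * (t - s)"])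
      case (trans r s t)
      show ?case
      proof
        assume *: "a \<le> r \<and> t \<le> b"
        have "Z s - Z r \<ge> - \<epsilon> * (s - r)" "Z t - Z s \<ge> - \<epsilon> * (t - s)"
          using trans * by auto
        then show "Z t - Z r \<ge> - \<epsilon> * (t - r)"
          by (simp add: algebra_simps)
      qed
    next
      case (local x)
      obtain W D d where W: "0 \<le> D" "0 < d" "(W has_real_derivative D) (at x within {a..b})" "W x = Z x"
        and right: "\<And>y. y \<in> {a..b} \<Longrightarrow> x \<le> y \<Longrightarrow> y < x + d \<Longrightarrow> W y \<le> Z y"
        and left: "\<And>y. y \<in> {a..b} \<Longrightarrow> x - d < y \<Longrightarrow> y \<le> x \<Longrightarrow> Z y \<le> W y"
        using support[OF local] by blast
      have "(W has_derivative (\<lambda>h. D * h)) (at x within {a..b})"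
        using W(3) by (simp add: has_field_derivative_def)
      then obtain e where "e > 0" and e: "\<And>y. y \<in> {a..b} \<Longrightarrow> \<bar>y - x\<bar> < e \<Longrightarrow>
            \<bar>W y - W x - D * (y - x)\<bar> \<le> \<epsilon> * \<bar>y - x\<bar>"
        using \<open>\<epsilon> > 0\<close> unfolding has_derivative_within_alt by (metis real_norm_def)
      show ?case
      proof (intro exI[of _ "min d e"] conjI allI impI)
        show "0 < min d e" using W \<open>e > 0\<close> by simp
        fix s t assume st: "s \<le> x \<and> x \<le> t \<and> t - s < min d e" and ab: "a \<le> s \<and> t \<le> b"
        have "\<bar>W t - W x - D * (t - x)\<bar> \<le> \<epsilon> * \<bar>t - x\<bar>" "W t \<le> Z t"
             "\<bar>W s - W x - D * (s - x)\<bar> \<le> \<epsilon> * \<bar>s - x\<bar>" "Z s \<le> W s"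
          using st ab e[of t] e[of s] right[of t] left[of s] by auto
        moreover have "D * (t - x) \<ge> 0" "D * (s - x) \<le> 0"
          using W(1) st by (auto intro: mult_nonneg_nonpos)
        moreover have "\<bar>t - x\<bar> = t - x" "\<bar>s - x\<bar> = x - s" using st by auto
        ultimately show "Z t - Z s \<ge> - \<epsilon> * (t - s)"
          by (simp add: algebra_simps)
      qed
    qed
    then show ?thesis by simp
  qed
  have "((\<lambda>\<epsilon>. - \<epsilon> * (b - a)) \<longlongrightarrow> - 0 * (b - a)) (at_right 0)"
    by (intro tendsto_intros)
  then have "Z b - Z a \<ge> 0"
    using bound by (intro tendsto_upperbound[of _ 0 "at_right 0"])
       (auto intro: eventually_mono[OF eventually_at_right_less])
  then show ?thesis by simp
qed

section \<open>Integrability of pairings in time\<close>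

text \<open>
  All that is needed of a function of time with values in the Hilbert space is the integrability
  of its norm and of its products with continuous functions. This suffices to do without vector
  valued integrals, and is shared by square integrable and by continuous functions.
\<close>

definition pairing_integrable_on :: "(real \<Rightarrow> 'a::real_inner) \<Rightarrow> real set \<Rightarrow> bool"
    (infixr "pairing'_integrable'_on" 46) where
  "f pairing_integrable_on S \<longleftrightarrow> (\<lambda>r. norm (f r)) integrable_on S \<and>
     (\<forall>w. continuous_on S w \<longrightarrow> (\<lambda>r. inner (f r) (w r)) integrable_on S)"

lemma continuous_imp_pairing_integrable:
  "continuous_on {a..b} f \<Longrightarrow> f pairing_integrable_on {a..b}"
  unfolding pairing_integrable_on_def
  by (auto intro!: integrable_continuous_real continuous_intros)

text \<open>
  A strongly measurable \<open>f\<close> is the limit almost everywhere of continuous functions, so scalar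
  functions formed continuously from \<open>f\<close> are limits almost everywhere of continuous scalar
  functions.
\<close>

lemma measurable_on_limit_borel:
  fixes f :: "real \<Rightarrow> 'a::real_normed_vector" and h :: "'a \<Rightarrow> real \<Rightarrow> real"
  assumes "f measurable_on {0<..<T}" "b < T"
    and cont: "\<And>g. continuous_on UNIV g \<Longrightarrow> continuous_on {0..b} (\<lambda>r. h (g r) r)"
    and lim: "\<And>g r. r \<in> {0..b} \<Longrightarrow> g \<longlonglongrightarrow> f r \<Longrightarrow> (\<lambda>n. h (g n) r) \<longlonglongrightarrow> h (f r) r"
  shows "(\<lambda>r. h (f r) r) \<in> borel_measurable (lebesgue_on {0..b})"
proof -
  obtain N g where N: "negligible N" and g: "\<And>n. continuous_on UNIV (g n :: real \<Rightarrow> 'a)"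
    "\<And>x. x \<notin> N \<Longrightarrow> (\<lambda>n. g n x) \<longlonglongrightarrow> (if x \<in> {0<..<T} then f x else 0)"
    using assms(1) unfolding measurable_on_def by blast
  have "(\<lambda>r. h (f r) r) measurable_on {0..b}"
  proof (rule measurable_on_limit)
    show "negligible (insert 0 N)" using N by (simp add: negligible_insert)
    show "(\<lambda>r. h (g n r) r) measurable_on {0..b}" for n
      using cont[OF g(1)[of n]]
      by (subst measurable_on_iff_borel_measurable)
         (auto intro: continuous_imp_measurable_on_sets_lebesgue)
    show "(\<lambda>n. h (g n x) x) \<longlonglongrightarrow> h (f x) x" if "x \<in> {0..b} - insert 0 N" for x
      using g(2)[of x] that \<open>b < T\<close> by (intro lim) auto
  qed
  then show ?thesis
    by (rule measurable_on_imp_borel_measurable_lebesgue) auto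
qed

lemma L2_on_imp_pairing_integrable:
  fixes f :: "real \<Rightarrow> 'a::real_inner"
  assumes "L2_on T f" "0 \<le> b" "b < T"
  shows "f pairing_integrable_on {0..b}"
proof -
  have f: "f measurable_on {0<..<T}"
    and "(\<lambda>t. (norm (f t))\<^sup>2) absolutely_integrable_on {0<..<T}"
    using assms(1) by (auto simp: L2_on_def)
  then have "(\<lambda>t. (norm (f t))\<^sup>2) absolutely_integrable_on {0<..<b}"
    using \<open>b < T\<close> by (elim set_integrable_subset) auto
  then have "(\<lambda>t. (norm (f t))\<^sup>2) integrable_on {0<..<b}"
    using absolutely_integrable_on_def by blast
  then have "(\<lambda>t. (norm (f t))\<^sup>2) integrable_on {0..b}"
    by (simp add: integrable_on_Icc_iff_Ioo)
  then have sq: "(\<lambda>t. 1 + (norm (f t))\<^sup>2) integrable_on {0..b}"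
    by (intro integrable_add) auto
  \<comment> \<open>On a bounded interval square integrability implies integrability, by \<open>x \<le> 1 + x\<^sup>2\<close>.\<close>
  have le: "x \<le> 1 + x\<^sup>2" for x :: real
    using zero_le_power2[of "x - 1/2"] by (simp add: power2_eq_square algebra_simps)
  have "(\<lambda>r. norm (f r)) \<in> borel_measurable (lebesgue_on {0..b})"
    using f assms(3)
    by (rule measurable_on_limit_borel[where h="\<lambda>x r. norm x"])
       (auto intro!: continuous_intros tendsto_norm intro: continuous_on_subset)
  then have norm_int: "(\<lambda>r. norm (f r)) integrable_on {0..b}"
    by (rule measurable_bounded_by_integrable_imp_integrable[OF _ sq]) (auto simp: le)
  moreover have "(\<lambda>r. inner (f r) (w r)) integrable_on {0..b}" if w: "continuous_on {0..b} w" for w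
  proof -
    have "bounded (w ` {0..b})"
      using w by (intro compact_imp_bounded compact_continuous_image) auto
    then obtain B where B: "\<And>r. r \<in> {0..b} \<Longrightarrow> norm (w r) \<le> B"
      unfolding bounded_iff by (metis imageI)
    have "(\<lambda>r. inner (f r) (w r)) \<in> borel_measurable (lebesgue_on {0..b})"
      using f assms(3)
      by (rule measurable_on_limit_borel[where h="\<lambda>x r. inner x (w r)"])
         (auto intro!: continuous_intros w tendsto_inner intro: continuous_on_subset)
    moreover have "(\<lambda>r. norm (f r) * B) integrable_on {0..b}"
      using norm_int by (rule integrable_on_mult_left)
    ultimately show ?thesis
    proof (rule measurable_bounded_by_integrable_imp_integrable)
      show "norm (inner (f r) (w r)) \<le> norm (f r) * B" if "r \<in> {0..b}" for r
        using Cauchy_Schwarz_ineq2[of "f r" "w r"] B[OF that]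
        by (metis mult_left_mono norm_ge_zero order_trans real_norm_def)
    qed auto
  qed
  ultimately show ?thesis by (simp add: pairing_integrable_on_def)
qed

section \<open>Symmetric operators along curves\<close>

lemma norm_le_if_inner_le_on_dense:
  fixes x :: "'a::real_inner"
  assumes "closure D = UNIV" "0 \<le> M" "\<And>v. v \<in> D \<Longrightarrow> inner x v \<le> M * norm v"
  shows "norm x \<le> M"
proof -
  have "closed {v. inner x v \<le> M * norm v}"
    by (intro closed_Collect_le continuous_intros)
  then have "closure D \<subseteq> {v. inner x v \<le> M * norm v}"
    using assms(3) by (intro closure_minimal) auto
  then have "inner x x \<le> M * norm x"
    using assms(1) by auto
  then have "norm x * norm x \<le> M * norm x"
    by (simp add: dot_square_norm power2_eq_square)
  then show ?thesis
    using assms(2) by (cases "norm x = 0") (auto dest: mult_right_le_imp_le)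
qed

lemma pairing_integrable_on_subinterval:
  assumes "f pairing_integrable_on {0..b}" "0 \<le> s" "t \<le> b"
  shows "(\<lambda>r. norm (f r)) integrable_on {s..t}"
    and "continuous_on {0..b} w \<Longrightarrow> (\<lambda>r. inner (f r) (w r)) integrable_on {s..t}"
  using assms unfolding pairing_integrable_on_def
  by (auto intro!: integrable_on_subinterval[of _ "{0..b}" s t])

lemma norm_has_integral_le_integral:
  fixes f g :: "real \<Rightarrow> real"
  assumes "(f has_integral I) S" "g integrable_on S" "\<And>x. x \<in> S \<Longrightarrow> norm (f x) \<le> g x"
  shows "norm I \<le> integral S g"
proof -
  have "f integrable_on S" "integral S f = I"
    using assms(1) by (auto intro: has_integral_integrable)
  with integral_norm_bound_integral[OF this(1) assms(2,3)] show ?thesis by simp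
qed

lemma integral_increment:
  fixes f :: "real \<Rightarrow> real"
  assumes "f integrable_on {0..b}" "0 \<le> s" "s \<le> t" "t \<le> b"
  shows "integral {0..t} f - integral {0..s} f = integral {s..t} f"
    and "(f has_integral (integral {0..t} f - integral {0..s} f)) {s..t}"
proof -
  have "f integrable_on {0..t}" and st: "f integrable_on {s..t}"
    using assms by (auto intro: integrable_on_subinterval)
  from Henstock_Kurzweil_Integration.integral_combine[OF assms(2,3) this(1)]
  show *: "integral {0..t} f - integral {0..s} f = integral {s..t} f" by simp
  show "(f has_integral (integral {0..t} f - integral {0..s} f)) {s..t}"
    unfolding * using st by (rule integrable_integral)
qed

text \<open>
  Symmetry and density of the domain make such an operator closable, which is the abstract reason
  why it may be interchanged with time integration. The lemmas below obtain this directly: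
  \<open>L v - L w\<close> is paired with an element of the domain, and the operator is moved to that element.
\<close>

locale symmetric_densely_defined =
  fixes D :: "'a::real_inner set" and L :: "'a \<Rightarrow> 'a"
  assumes dense: "closure D = UNIV" and sym: "symmetric_on D L"
begin

lemma inner_swap: "v \<in> D \<Longrightarrow> w \<in> D \<Longrightarrow> inner (L v) w = inner v (L w)"
  using sym by (simp add: symmetric_on_def)

text \<open>
  The curve \<open>v\<close> is the integral of \<open>w\<close> in the weak sense, that is after pairing with each fixed
  element \<open>x\<close>. As \<open>w\<close> may be a second derivative that is defined up to null sets, it need
  lie in the domain only almost everywhere.
\<close>

definition curve_with_density :: "real \<Rightarrow> (real \<Rightarrow> 'a) \<Rightarrow> (real \<Rightarrow> 'a) \<Rightarrow> bool" where
  "curve_with_density b v w \<longleftrightarrow>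
     (\<forall>t\<in>{0..b}. v t \<in> D) \<and> continuous_on {0..b} v \<and>
     (\<exists>N. negligible N \<and> (\<forall>r\<in>{0..b} - N. w r \<in> D)) \<and>
     (\<forall>x. \<forall>t\<in>{0..b}. ((\<lambda>r. inner (w r) x) has_integral inner (v t - v 0) x) {0..t}) \<and>
     (\<lambda>r. L (w r)) pairing_integrable_on {0..b}"

text \<open>
  Moving \<open>L\<close> to the test element \<open>x\<close> reduces the claim to the weak integral of \<open>w\<close> itself.
\<close>

lemma inner_increment_image:
  assumes c: "curve_with_density b v w" and st: "0 \<le> s" "s \<le> t" "t \<le> b" and "x \<in> D"
  shows "((\<lambda>r. inner (L (w r)) x) has_integral inner (L (v t) - L (v s)) x) {s..t}"
proof -
  obtain N where N: "negligible N" "\<And>r. r \<in> {0..b} - N \<Longrightarrow> w r \<in> D"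
    using c by (auto simp: curve_with_density_def)
  have int: "((\<lambda>r. inner (w r) (L x)) has_integral inner (v y - v 0) (L x)) {0..y}"
    if "y \<in> {0..b}" for y
    using c that by (simp add: curve_with_density_def)
  have vD: "v s \<in> D" "v t \<in> D"
    using c st by (auto simp: curve_with_density_def)
  have "(\<lambda>r. inner (w r) (L x)) integrable_on {0..b}"
    using int[of b] st by (auto intro: has_integral_integrable)
  from integral_increment(2)[OF this st] have "((\<lambda>r. inner (w r) (L x)) has_integral
      (integral {0..t} (\<lambda>r. inner (w r) (L x)) - integral {0..s} (\<lambda>r. inner (w r) (L x)))) {s..t}"
    .
  moreover have "integral {0..t} (\<lambda>r. inner (w r) (L x)) - integral {0..s} (\<lambda>r. inner (w r) (L x))
      = inner (L (v t) - L (v s)) x"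
    using int[of t] int[of s] st vD \<open>x \<in> D\<close>
    by (simp add: integral_unique inner_diff_left inner_swap)
  ultimately have "((\<lambda>r. inner (w r) (L x)) has_integral inner (L (v t) - L (v s)) x) {s..t}"
    by simp
  then show ?thesis
    by (rule has_integral_spike[OF N(1), rotated]) (use N(2) st \<open>x \<in> D\<close> in \<open>auto simp: inner_swap\<close>)
qed

lemma norm_increment_image:
  assumes c: "curve_with_density b v w" and st: "0 \<le> s" "s \<le> t" "t \<le> b"
  shows "norm (L (v t) - L (v s)) \<le> integral {s..t} (\<lambda>r. norm (L (w r)))"
proof (rule norm_le_if_inner_le_on_dense[OF dense])
  have int: "(\<lambda>r. norm (L (w r))) integrable_on {s..t}"
    using c st pairing_integrable_on_subinterval(1) by (auto simp: curve_with_density_def)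
  then show "0 \<le> integral {s..t} (\<lambda>r. norm (L (w r)))"
    by (intro integral_nonneg) auto
  fix x assume "x \<in> D"
  show "inner (L (v t) - L (v s)) x \<le> integral {s..t} (\<lambda>r. norm (L (w r))) * norm x"
  proof (rule has_integral_le)
    show "((\<lambda>r. inner (L (w r)) x) has_integral inner (L (v t) - L (v s)) x) {s..t}"
      by (rule inner_increment_image) fact+
    show "((\<lambda>r. norm (L (w r)) * norm x) has_integral integral {s..t} (\<lambda>r. norm (L (w r))) * norm x) {s..t}"
      using int by (intro has_integral_mult_left integrable_integral)
  qed (simp add: norm_cauchy_schwarz)
qed

lemma continuous_on_image:
  assumes c: "curve_with_density b v w"
  shows "continuous_on {0..b} (\<lambda>t. L (v t))"
proof -
  define N where "N t = integral {0..t} (\<lambda>r. norm (L (w r)))" for t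
  have int: "(\<lambda>r. norm (L (w r))) integrable_on {0..b}"
    using c by (auto simp: curve_with_density_def pairing_integrable_on_def)
  then have contN: "continuous_on {0..b} N"
    unfolding N_def by (rule indefinite_integral_continuous_1)
  have mono: "dist (L (v t)) (L (v s)) \<le> dist (N t) (N s)" if "s \<in> {0..b}" "t \<in> {0..b}" "s \<le> t" for s t
    using norm_increment_image[OF c, of s t] integral_increment(1)[OF int, of s t] that
    by (simp add: dist_norm N_def)
  have le: "dist (L (v t)) (L (v s)) \<le> dist (N t) (N s)" if "s \<in> {0..b}" "t \<in> {0..b}" for s t
    using mono[of s t] mono[of t s] that by (cases "s \<le> t") (auto simp: dist_commute)
  show ?thesis
    unfolding continuous_on_iff
  proof (intro ballI allI impI)
    fix x e :: real assume x: "x \<in> {0..b}" and "e > 0"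
    then obtain d where "d > 0" "\<And>y. y \<in> {0..b} \<Longrightarrow> dist y x < d \<Longrightarrow> dist (N y) (N x) < e"
      using contN unfolding continuous_on_iff by blast
    then show "\<exists>d>0. \<forall>x'\<in>{0..b}. dist x' x < d \<longrightarrow> dist (L (v x')) (L (v x)) < e"
      using le[OF x] by (meson le_less_trans)
  qed
qed

text \<open>
  On a short interval \<open>[s, t]\<close> the increment of \<open>(L v1, v2)\<close> is
  \<open>(L v1(t) - L v1(s), v2(t)) + (v1(s), L v2(t) - L v2(s))\<close>, where symmetry has been used in the
  second term. Here \<open>v2(t)\<close> and \<open>v1(s)\<close> are fixed elements of the domain, so both terms are
  integrals over \<open>[s, t]\<close> that differ from the asserted one only in that \<open>v2\<close> and \<open>v1\<close> are frozen at an end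
  point. By uniform continuity the error is negligible against the integral of
  \<open>|L w1| + |L w2|\<close>.
\<close>

lemma product_rule:
  assumes c1: "curve_with_density b v1 w1" and c2: "curve_with_density b v2 w2"
    and ab: "0 \<le> s0" "s0 \<le> t0" "t0 \<le> b"
  shows "((\<lambda>r. inner (L (w1 r)) (v2 r) + inner (v1 r) (L (w2 r))) has_integral
           inner (L (v1 t0)) (v2 t0) - inner (L (v1 s0)) (v2 s0)) {s0..t0}"
proof -
  define k where "k r = inner (L (w1 r)) (v2 r) + inner (L (w2 r)) (v1 r)" for r
  define n where "n r = norm (L (w1 r)) + norm (L (w2 r))" for r
  define q where "q t = inner (L (v1 t)) (v2 t) - integral {0..t} k" for t
  have D: "v1 r \<in> D" "v2 r \<in> D" if "r \<in> {0..b}" for r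
    using c1 c2 that by (auto simp: curve_with_density_def)
  have cont: "continuous_on {0..b} v1" "continuous_on {0..b} v2"
    using c1 c2 by (auto simp: curve_with_density_def)
  have pint: "(\<lambda>r. L (w1 r)) pairing_integrable_on {0..b}" "(\<lambda>r. L (w2 r)) pairing_integrable_on {0..b}"
    using c1 c2 by (auto simp: curve_with_density_def)
  have kint: "k integrable_on {0..b}"
    using pint cont unfolding k_def pairing_integrable_on_def by (auto intro!: integrable_add)
  have nint: "n integrable_on {0..b}"
    using pint unfolding n_def pairing_integrable_on_def by (auto intro!: integrable_add)
  have "q t0 = q s0"
  proof (rule constant_if_increments_negligible[OF ab(2), where N="\<lambda>t. integral {0..t} n"])
    fix e :: real assume "e > 0"
    have "uniformly_continuous_on {0..b} v1" "uniformly_continuous_on {0..b} v2"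
      using cont by (auto intro: compact_uniformly_continuous)
    then obtain d1 d2 where d: "d1 > 0" "d2 > 0"
      and d1: "\<And>x y. x \<in> {0..b} \<Longrightarrow> y \<in> {0..b} \<Longrightarrow> dist x y < d1 \<Longrightarrow> dist (v1 x) (v1 y) < e"
      and d2: "\<And>x y. x \<in> {0..b} \<Longrightarrow> y \<in> {0..b} \<Longrightarrow> dist x y < d2 \<Longrightarrow> dist (v2 x) (v2 y) < e"
      using \<open>e > 0\<close> unfolding uniformly_continuous_on_def by metis
    show "\<exists>\<delta>>0. \<forall>s t. s0 \<le> s \<and> s \<le> t \<and> t \<le> t0 \<and> t - s < \<delta> \<longrightarrow>
            \<bar>q t - q s\<bar> \<le> e * (integral {0..t} n - integral {0..s} n)"
    proof (intro exI[of _ "min d1 d2"] conjI allI impI)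
      fix s t assume "s0 \<le> s \<and> s \<le> t \<and> t \<le> t0 \<and> t - s < min d1 d2"
      then have st: "0 \<le> s" "s \<le> t" "t \<le> b" "t - s < d1" "t - s < d2" using ab by auto
      have kst: "(k has_integral (integral {0..t} k - integral {0..s} k)) {s..t}"
        by (rule integral_increment(2)[OF kint st(1-3)])
      have i1: "((\<lambda>r. inner (L (w1 r)) (v2 t)) has_integral inner (L (v1 t) - L (v1 s)) (v2 t)) {s..t}"
        using c1 st D(2)[of t] by (intro inner_increment_image) auto
      have i2: "((\<lambda>r. inner (L (w2 r)) (v1 s)) has_integral inner (L (v2 t) - L (v2 s)) (v1 s)) {s..t}"
        using c2 st D(1)[of s] by (intro inner_increment_image) auto
      have "((\<lambda>r. inner (L (w1 r)) (v2 t) + inner (L (w2 r)) (v1 s) - k r) has_integral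
          (inner (L (v1 t) - L (v1 s)) (v2 t) + inner (L (v2 t) - L (v2 s)) (v1 s)
             - (integral {0..t} k - integral {0..s} k))) {s..t}"
        by (intro has_integral_diff has_integral_add i1 i2 kst)
      moreover have "inner (L (v1 t) - L (v1 s)) (v2 t) + inner (L (v2 t) - L (v2 s)) (v1 s)
             - (integral {0..t} k - integral {0..s} k) = q t - q s"
        using inner_swap[of "v2 t" "v1 s"] inner_swap[of "v2 s" "v1 s"] D[of s] D[of t] st
        by (simp add: q_def inner_diff_left) (simp add: inner_commute)
      ultimately have "((\<lambda>r. inner (L (w1 r)) (v2 t) + inner (L (w2 r)) (v1 s) - k r) has_integral
          q t - q s) {s..t}"
        by simp
      moreover have "n integrable_on {s..t}"
        using integrable_on_subinterval[OF nint, of s t] st by auto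
      \<comment> \<open>The error made by freezing \<open>v2\<close> at \<open>t\<close> and \<open>v1\<close> at \<open>s\<close>.\<close>
      moreover have "norm (inner (L (w1 r)) (v2 t) + inner (L (w2 r)) (v1 s) - k r) \<le> e * n r"
        if "r \<in> {s..t}" for r
      proof -
        have "norm (v2 t - v2 r) \<le> e" "norm (v1 s - v1 r) \<le> e"
          using d2[of t r] d1[of s r] that st by (auto simp: dist_norm)
        then have "\<bar>inner (L (w1 r)) (v2 t - v2 r)\<bar> \<le> norm (L (w1 r)) * e"
          "\<bar>inner (L (w2 r)) (v1 s - v1 r)\<bar> \<le> norm (L (w2 r)) * e"
          by (meson Cauchy_Schwarz_ineq2 mult_left_mono norm_ge_zero order_trans)+
        then show ?thesis
          by (simp add: k_def n_def inner_diff_right algebra_simps)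
      qed
      ultimately have "norm (q t - q s) \<le> integral {s..t} (\<lambda>r. e * n r)"
        by (intro norm_has_integral_le_integral) (auto intro: integrable_on_mult_right)
      then show "\<bar>q t - q s\<bar> \<le> e * (integral {0..t} n - integral {0..s} n)"
        using integral_increment(1)[OF nint st(1-3)] by simp
    qed (use d in auto)
  qed
  moreover have "(k has_integral (integral {0..t0} k - integral {0..s0} k)) {s0..t0}"
    by (rule integral_increment(2)[OF kint ab])
  moreover have "integral {0..t0} k - integral {0..s0} k
      = inner (L (v1 t0)) (v2 t0) - inner (L (v1 s0)) (v2 s0)"
    using calculation(1) by (simp add: q_def)
  ultimately show ?thesis
    by (simp add: k_def[abs_def] inner_commute)
qed

end

section \<open>Quadratic forms along continuously differentiable curves\<close>

lemma uniform_difference_quotient: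
  fixes v v' :: "real \<Rightarrow> 'a::real_normed_vector"
  assumes der: "\<And>t. t \<in> {0..b} \<Longrightarrow> (v has_vector_derivative v' t) (at t within {0..b})"
    and cont: "continuous_on {0..b} v'" and "\<epsilon> > 0"
  obtains \<delta> where "\<delta> > 0"
    "\<And>s t c. 0 \<le> s \<Longrightarrow> s \<le> t \<Longrightarrow> t \<le> b \<Longrightarrow> t - s < \<delta> \<Longrightarrow> c \<in> {s..t} \<Longrightarrow>
       norm (v t - v s - (t - s) *\<^sub>R v' c) \<le> \<epsilon> * (t - s)"
proof -
  have "uniformly_continuous_on {0..b} v'"
    using cont by (auto intro: compact_uniformly_continuous)
  then obtain d where "d > 0"
    and d: "\<And>x y. x \<in> {0..b} \<Longrightarrow> y \<in> {0..b} \<Longrightarrow> dist x y < d \<Longrightarrow> dist (v' x) (v' y) < \<epsilon>"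
    using \<open>\<epsilon> > 0\<close> unfolding uniformly_continuous_on_def by metis
  show thesis
  proof (rule that[OF \<open>d > 0\<close>])
    fix s t c assume st: "0 \<le> s" "s \<le> t" "t \<le> b" "t - s < d" "c \<in> {s..t}"
    have "norm (v t - v s - (t - s) *\<^sub>R v' c) \<le> norm (t - s) * \<epsilon>"
    proof (rule vector_differentiable_bound_linearization[where S="{s..t}" and ?x0.0=c and f'=v'])
      show "(v has_vector_derivative v' x) (at x within {s..t})" if "x \<in> {s..t}" for x
        using that st by (intro has_vector_derivative_within_subset[OF der]) auto
      show "norm (v' x - v' c) \<le> \<epsilon>" if "x \<in> {s..t}" for x
      proof -
        have "dist x c < d" using that st by (auto simp: dist_real_def)
        then show ?thesis using d[of x c] that st by (auto simp: dist_norm)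
      qed
    qed (use st in \<open>auto simp: closed_segment_eq_real_ivl\<close>)
    then show "norm (v t - v s - (t - s) *\<^sub>R v' c) \<le> \<epsilon> * (t - s)"
      using st by (simp add: mult.commute)
  qed
qed

lemma lipschitz_if_continuously_differentiable:
  fixes v v' :: "real \<Rightarrow> 'a::real_normed_vector"
  assumes der: "\<And>t. t \<in> {0..b} \<Longrightarrow> (v has_vector_derivative v' t) (at t within {0..b})"
    and cont: "continuous_on {0..b} v'"
  obtains M where "0 \<le> M" "\<And>s t. 0 \<le> s \<Longrightarrow> s \<le> t \<Longrightarrow> t \<le> b \<Longrightarrow> norm (v t - v s) \<le> M * (t - s)"
proof -
  have "bounded (v' ` {0..b})"
    using cont by (intro compact_imp_bounded compact_continuous_image) auto
  then obtain M where M: "0 < M" "\<And>r. r \<in> {0..b} \<Longrightarrow> norm (v' r) \<le> M"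
    unfolding bounded_pos by (metis imageI)
  show thesis
  proof (rule that[of M])
    fix s t assume st: "0 \<le> s" "s \<le> t" "t \<le> b"
    have "norm (v t - v s) \<le> M * norm (t - s)"
    proof (rule differentiable_bound)
      show "convex {s..t}" by simp
      show "(v has_derivative (\<lambda>h. h *\<^sub>R v' x)) (at x within {s..t})" if "x \<in> {s..t}" for x
        using has_vector_derivative_within_subset[OF der, of x "{s..t}"] that st
        by (auto simp: has_vector_derivative_def)
      show "onorm (\<lambda>h. h *\<^sub>R v' x) \<le> M" if "x \<in> {s..t}" for x
      proof (rule onorm_le)
        show "norm (h *\<^sub>R v' x) \<le> M * norm h" for h
          using mult_left_mono[OF M(2)[of x], of "norm h"] that st by (simp add: mult.commute)
      qed
    qed (use st in auto)
    then show "norm (v t - v s) \<le> M * (t - s)" using st by simp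
  qed (use M in auto)
qed

lemma right_limit_of_continuous_on:
  fixes f :: "real \<Rightarrow> real"
  assumes "continuous_on {0..b} f" "0 \<le> x" "x < b"
  shows "((\<lambda>h. f (x + h)) \<longlongrightarrow> f x) (at_right 0)"
proof -
  have "(f \<longlongrightarrow> f x) (at x within {x..b})"
    using continuous_on_subset[of "{0..b}" f "{x..b}"] assms by (auto simp: continuous_on_def)
  then have "(f \<longlongrightarrow> f x) (at_right x)"
    using assms by (simp add: at_within_Icc_at_right)
  then show ?thesis
    by (simp add: filterlim_at_right_to_0[of f _ x] add.commute)
qed

context symmetric_densely_defined
begin

text \<open>
  Every \<open>x\<close> is a right Lebesgue point of \<open>g = (L v, v)\<close>, although \<open>g\<close> is not known to be continuous.
  By symmetry \<open>g(r) - g(x) = (L v(r) + L v(x), v(r) - v(x))\<close>. The second factor is \<open>O(r - x)\<close>, and this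
  small factor compensates for the fact that \<open>L v\<close> is merely integrable.
\<close>

lemma form_right_mean_value:
  assumes D: "\<And>t. t \<in> {0..b} \<Longrightarrow> v t \<in> D"
    and der: "\<And>t. t \<in> {0..b} \<Longrightarrow> (v has_vector_derivative v' t) (at t within {0..b})"
    and cont': "continuous_on {0..b} v'"
    and pint: "(\<lambda>r. L (v r)) pairing_integrable_on {0..b}"
    and x: "0 \<le> x" "x < b"
  defines "g \<equiv> \<lambda>r. inner (L (v r)) (v r)"
  shows "((\<lambda>h. (integral {0..x+h} g - integral {0..x} g) / h) \<longlongrightarrow> g x) (at_right 0)"
proof -
  define n where "n r = norm (L (v r))" for r
  define N where "N t = integral {0..t} n" for t
  have contv: "continuous_on {0..b} v"
    using der by (meson continuous_on_eq_continuous_within has_vector_derivative_continuous)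
  have gint: "g integrable_on {0..b}" and nint: "n integrable_on {0..b}"
    using pint contv by (auto simp: pairing_integrable_on_def g_def[abs_def] n_def[abs_def])
  obtain M where M: "0 \<le> M" "\<And>s t. 0 \<le> s \<Longrightarrow> s \<le> t \<Longrightarrow> t \<le> b \<Longrightarrow> norm (v t - v s) \<le> M * (t - s)"
    using lipschitz_if_continuously_differentiable[OF der cont'] by metis
  have bound: "norm ((integral {0..x+h} g - integral {0..x} g) / h - g x)
      \<le> M * (N (x + h) - N x + h * n x)" if h: "0 < h" "h < b - x" for h
  proof -
    have "(g has_integral (integral {0..x+h} g - integral {0..x} g)) {x..x+h}"
      using h x by (intro integral_increment(2)[OF gint]) auto
    then have "((\<lambda>r. g r - g x) has_integral (integral {0..x+h} g - integral {0..x} g) - h * g x) {x..x+h}"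
      using has_integral_diff[OF _ has_integral_const_real[of "g x" x "x+h"]] h by simp
    moreover have "n integrable_on {x..x+h}"
      using h x integrable_on_subinterval[OF nint, of x "x+h"] by auto
    then have int: "(\<lambda>r. (n r + n x) * (M * h)) integrable_on {x..x+h}"
      by (intro integrable_on_mult_left integrable_add) auto
    moreover have "norm (g r - g x) \<le> (n r + n x) * (M * h)" if r: "r \<in> {x..x+h}" for r
    proof -
      have "norm (v r - v x) \<le> M * h"
        using M(2)[of x r] r h x mult_left_mono[of "r - x" h M] M(1) by auto
      then have b: "\<bar>inner z (v r - v x)\<bar> \<le> norm z * (M * h)" for z
        by (meson Cauchy_Schwarz_ineq2 mult_left_mono norm_ge_zero order_trans)
      have "g r - g x = inner (L (v r)) (v r - v x) + inner (L (v x)) (v r - v x)"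
        using inner_swap[of "v r" "v x"] D[of r] D[of x] r h x
        by (simp add: g_def inner_diff_right) (simp add: inner_commute)
      then show ?thesis
        using b[of "L (v r)"] b[of "L (v x)"] by (simp add: n_def algebra_simps)
    qed
    ultimately have "norm ((integral {0..x+h} g - integral {0..x} g) - h * g x)
        \<le> integral {x..x+h} (\<lambda>r. (n r + n x) * (M * h))"
      by (rule norm_has_integral_le_integral)
    also have "\<dots> = (N (x + h) - N x + h * n x) * (M * h)"
    proof (rule integral_unique)
      have "(n has_integral N (x + h) - N x) {x..x+h}"
        unfolding N_def using h x by (intro integral_increment(2)[OF nint]) auto
      from has_integral_mult_left[OF has_integral_add[OF this has_integral_const_real[of "n x"]]]
      show "((\<lambda>r. (n r + n x) * (M * h)) has_integral (N (x + h) - N x + h * n x) * (M * h)) {x..x+h}"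
        using h by simp
    qed
    finally have "norm ((integral {0..x+h} g - integral {0..x} g) - h * g x) / h
        \<le> M * (N (x + h) - N x + h * n x)"
      using h by (simp add: field_simps)
    moreover have "(integral {0..x+h} g - integral {0..x} g) / h - g x
        = ((integral {0..x+h} g - integral {0..x} g) - h * g x) / h"
      using h by (simp add: field_simps)
    ultimately show ?thesis
      using h by (simp only: norm_divide) simp
  qed
  have "continuous_on {0..b} N"
    unfolding N_def using nint by (rule indefinite_integral_continuous_1)
  then have "((\<lambda>h. N (x + h)) \<longlongrightarrow> N x) (at_right 0)"
    by (rule right_limit_of_continuous_on) (use x in auto)
  then have "((\<lambda>h. M * (N (x + h) - N x + h * n x)) \<longlongrightarrow> M * (N x - N x + 0 * n x)) (at_right 0)"
    by (intro tendsto_intros)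
  then have "((\<lambda>h. M * (N (x + h) - N x + h * n x)) \<longlongrightarrow> 0) (at_right 0)" by simp
  then have "((\<lambda>h. (integral {0..x+h} g - integral {0..x} g) / h - g x) \<longlongrightarrow> 0) (at_right 0)"
    by (rule Lim_null_comparison[rotated])
       (use bound x in \<open>auto simp: eventually_at_right_field intro!: exI[of _ "b - x"]\<close>)
  then show ?thesis
    by (simp add: LIM_zero_iff)
qed

text \<open>
  Formally \<open>(L v, v)' = 2 (L v, v')\<close>, but \<open>L v\<close> may be unbounded in time and \<open>L v'\<close> not integrable, so
  the product rule above does not apply. Instead, compare the average of \<open>g = (L v, v)\<close> over \<open>[t, t + h]\<close>
  with that over \<open>[0, h]\<close>. Their difference, times \<open>h\<close>, is the integral of \<open>g\<close> over \<open>[h, t + h]\<close> minus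
  that over \<open>[0, t]\<close>. Insert
  the integral \<open>X\<close> of \<open>(L v(r), v(r + h))\<close> over \<open>[0, t]\<close>, which by symmetry and a shift
  is also the integral of \<open>(L v(r), v(r - h))\<close> over \<open>[h, t + h]\<close>. In both resulting differences
  \<open>L v(r)\<close> is paired with an increment of \<open>v\<close>, and these increments are uniformly close to \<open>h v'(r)\<close>.
  As \<open>h\<close> tends to \<open>0\<close>, the averages converge to \<open>g(t)\<close> and \<open>g(0)\<close> by the previous lemma.
\<close>

lemma form_increment:
  assumes D: "\<And>t. t \<in> {0..b} \<Longrightarrow> v t \<in> D"
    and der: "\<And>t. t \<in> {0..b} \<Longrightarrow> (v has_vector_derivative v' t) (at t within {0..b})"
    and cont': "continuous_on {0..b} v'"
    and pint: "(\<lambda>r. L (v r)) pairing_integrable_on {0..b}"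
    and t: "0 \<le> t" "t < b"
  shows "inner (L (v t)) (v t) - inner (L (v 0)) (v 0) = 2 * integral {0..t} (\<lambda>r. inner (L (v r)) (v' r))"
proof -
  define g where "g r = inner (L (v r)) (v r)" for r
  define n where "n r = norm (L (v r))" for r
  define j where "j r = inner (L (v r)) (v' r)" for r
  define \<Gamma> where "\<Gamma> x = integral {0..x} g" for x
  define J where "J x = integral {0..x} j" for x
  define N where "N = integral {0..b} n"
  have contv: "continuous_on {0..b} v"
    using der by (meson continuous_on_eq_continuous_within has_vector_derivative_continuous)
  have gint: "g integrable_on {0..b}" and nint: "n integrable_on {0..b}" and jint: "j integrable_on {0..b}"
    using pint contv cont' by (auto simp: pairing_integrable_on_def g_def[abs_def] n_def[abs_def] j_def[abs_def])
  have nsub: "n integrable_on {s..r}" "integral {s..r} n \<le> N" if "0 \<le> s" "r \<le> b" for s r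
  proof -
    show i: "n integrable_on {s..r}"
      using integrable_on_subinterval[OF nint, of s r] that by auto
    show "integral {s..r} n \<le> N"
      unfolding N_def using that by (intro integral_subset_le i nint) (auto simp: n_def)
  qed
  have est: "\<exists>\<delta>>0. \<forall>h. 0 < h \<and> h < \<delta> \<longrightarrow>
      \<bar>(\<Gamma> (t+h) - \<Gamma> t) / h - (\<Gamma> h - \<Gamma> 0) / h - (J (t+h) - J h + J t)\<bar> \<le> 2 * \<epsilon> * N" if eps: "\<epsilon> > 0" for \<epsilon>
  proof -
    obtain \<delta> where "\<delta> > 0" and \<delta>: "\<And>s t c. 0 \<le> s \<Longrightarrow> s \<le> t \<Longrightarrow> t \<le> b \<Longrightarrow> t - s < \<delta> \<Longrightarrow> c \<in> {s..t} \<Longrightarrow>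
       norm (v t - v s - (t - s) *\<^sub>R v' c) \<le> \<epsilon> * (t - s)"
      using uniform_difference_quotient[OF der cont' eps] by metis
    have pair: "\<bar>inner (L (v r)) z\<bar> \<le> \<epsilon> * h * n r" if "norm z \<le> \<epsilon> * h" for r z h
      using Cauchy_Schwarz_ineq2[of "L (v r)" z] mult_left_mono[OF that, of "n r"]
      by (simp add: n_def mult_ac)
    have main: "\<bar>\<Gamma> (t+h) - \<Gamma> h - \<Gamma> t - h * (J (t+h) - J h + J t)\<bar> \<le> h * (2 * \<epsilon> * N)"
      if h: "0 < h" "h < \<delta>" "h < b - t" for h
    proof -
      \<comment> \<open>The truncation only serves to have a continuous function on all of \<open>[0, b]\<close>.\<close>
      have "continuous_on {0..b} (\<lambda>r. v (min b (r + h)))"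
        using h by (intro continuous_on_compose2[OF contv]) (auto intro!: continuous_intros)
      then have "(\<lambda>r. inner (L (v r)) (v (min b (r + h)))) integrable_on {0..t}"
        using pairing_integrable_on_subinterval(2)[OF pint, of 0 t] t by auto
      then have fwd: "(\<lambda>r. inner (L (v r)) (v (r + h))) integrable_on {0..t}"
        by (rule integrable_eq) (use h in auto)
      define X where "X = integral {0..t} (\<lambda>r. inner (L (v r)) (v (r + h)))"
      have X0: "((\<lambda>r. inner (L (v r)) (v (r + h))) has_integral X) {0..t}"
        using fwd unfolding X_def by (rule integrable_integral)
      have "inner (L (v r)) (v (r + h)) = inner (L (v (r + h))) (v (r + h - h))" if "r \<in> {0..t}" for r
        using inner_swap[of "v r" "v (r + h)"] D[of r] D[of "r + h"] that h t
        by (simp add: inner_commute)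
      from has_integral_eq[OF this X0]
      have "((\<lambda>r. inner (L (v (r + h))) (v (r + h - h))) has_integral X) {h - h..t + h - h}"
        by simp
      then have Xh: "((\<lambda>r. inner (L (v r)) (v (r - h))) has_integral X) {h..t + h}"
        by (subst has_integral_shift_real_ivl_iff[of _ _ _ _ h])
      have "((\<lambda>r. g r - inner (L (v r)) (v (r - h)) - h * j r) has_integral
              (\<Gamma> (t+h) - \<Gamma> h) - X - h * (J (t+h) - J h)) {h..t + h}"
        unfolding \<Gamma>_def J_def using t h
        by (intro has_integral_diff has_integral_mult_right integral_increment(2)[OF gint]
            integral_increment(2)[OF jint] Xh) auto
      then have 1: "norm ((\<Gamma> (t+h) - \<Gamma> h) - X - h * (J (t+h) - J h)) \<le> integral {h..t+h} (\<lambda>r. \<epsilon> * h * n r)"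
      proof (rule norm_has_integral_le_integral)
        show "norm (g r - inner (L (v r)) (v (r - h)) - h * j r) \<le> \<epsilon> * h * n r" if "r \<in> {h..t+h}" for r
          using pair[of "v r - v (r - h) - h *\<^sub>R v' r" h r] \<delta>[of "r - h" r r] that h t
          by (simp add: g_def j_def inner_diff_right)
      qed (use nsub h t in \<open>auto intro: integrable_on_mult_right\<close>)
      have "((\<lambda>r. inner (L (v r)) (v (r + h)) - g r - h * j r) has_integral
              X - (\<Gamma> t - \<Gamma> 0) - h * (J t - J 0)) {0..t}"
        unfolding \<Gamma>_def J_def using t h
        by (intro has_integral_diff has_integral_mult_right integral_increment(2)[OF gint]
            integral_increment(2)[OF jint] X0) auto
      then have "norm (X - (\<Gamma> t - \<Gamma> 0) - h * (J t - J 0)) \<le> integral {0..t} (\<lambda>r. \<epsilon> * h * n r)"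
      proof (rule norm_has_integral_le_integral)
        show "norm (inner (L (v r)) (v (r + h)) - g r - h * j r) \<le> \<epsilon> * h * n r" if "r \<in> {0..t}" for r
          using pair[of "v (r + h) - v r - h *\<^sub>R v' r" h r] \<delta>[of r "r + h" r] that h t
          by (simp add: g_def j_def inner_diff_right)
      qed (use nsub h t in \<open>auto intro: integrable_on_mult_right\<close>)
      moreover have "integral {0..t} (\<lambda>r. \<epsilon> * h * n r) \<le> \<epsilon> * h * N"
        "integral {h..t+h} (\<lambda>r. \<epsilon> * h * n r) \<le> \<epsilon> * h * N"
        using nsub(2)[of 0 t] nsub(2)[of h "t+h"] t h \<open>\<epsilon> > 0\<close> by (auto intro!: mult_left_mono)
      ultimately show ?thesis
        using 1 by (simp add: \<Gamma>_def J_def algebra_simps)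
    qed
    show ?thesis
    proof (intro exI[of _ "min \<delta> (b - t)"] conjI allI impI)
      fix h assume "0 < h \<and> h < min \<delta> (b - t)"
      then have h: "0 < h" "h < \<delta>" "h < b - t" by auto
      have "(\<Gamma> (t+h) - \<Gamma> t) / h - (\<Gamma> h - \<Gamma> 0) / h - (J (t+h) - J h + J t)
          = (\<Gamma> (t+h) - \<Gamma> h - \<Gamma> t - h * (J (t+h) - J h + J t)) / h"
        using h by (simp add: \<Gamma>_def field_simps)
      then show "\<bar>(\<Gamma> (t+h) - \<Gamma> t) / h - (\<Gamma> h - \<Gamma> 0) / h - (J (t+h) - J h + J t)\<bar> \<le> 2 * \<epsilon> * N"
        using main[OF h] h by (simp add: abs_divide pos_divide_le_eq mult.commute)
    qed (use \<open>\<delta> > 0\<close> t in auto)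
  qed
  have "N \<ge> 0" unfolding N_def by (intro integral_nonneg nint) (simp add: n_def)
  define Q where "Q h = (\<Gamma> (t+h) - \<Gamma> t) / h - (\<Gamma> h - \<Gamma> 0) / h - (J (t+h) - J h + J t)" for h
  have "(Q \<longlongrightarrow> 0) (at_right 0)"
  proof (rule tendstoI)
    fix e :: real assume "e > 0"
    define \<epsilon> where "\<epsilon> = e / (2 * N + 1) / 2"
    have "\<epsilon> > 0" using \<open>e > 0\<close> \<open>N \<ge> 0\<close> by (simp add: \<epsilon>_def)
    have "2 * \<epsilon> * N < e"
      using \<open>e > 0\<close> \<open>N \<ge> 0\<close> by (simp add: \<epsilon>_def field_simps add_pos_nonneg)
    obtain \<delta> where "\<delta> > 0" "\<And>h. 0 < h \<Longrightarrow> h < \<delta> \<Longrightarrow> \<bar>Q h\<bar> \<le> 2 * \<epsilon> * N"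
      using est[OF \<open>\<epsilon> > 0\<close>] unfolding Q_def by blast
    then show "eventually (\<lambda>h. dist (Q h) 0 < e) (at_right 0)"
      using \<open>2 * \<epsilon> * N < e\<close> by (force simp: eventually_at_right_field intro!: exI[of _ \<delta>])
  qed
  moreover have "(Q \<longlongrightarrow> g t - g 0 - (J t - J 0 + J t)) (at_right 0)"
  proof -
    have "continuous_on {0..b} J"
      unfolding J_def using jint by (rule indefinite_integral_continuous_1)
    then have "((\<lambda>h. J (t + h)) \<longlongrightarrow> J t) (at_right 0)" "((\<lambda>h. J (0 + h)) \<longlongrightarrow> J 0) (at_right 0)"
      using t by (auto intro!: right_limit_of_continuous_on simp del: add_0)
    moreover have "((\<lambda>h. (\<Gamma> (t + h) - \<Gamma> t) / h) \<longlongrightarrow> g t) (at_right 0)"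
      "((\<lambda>h. (\<Gamma> (0 + h) - \<Gamma> 0) / h) \<longlongrightarrow> g 0) (at_right 0)"
      using form_right_mean_value[OF D der cont' pint, of t] t
        form_right_mean_value[OF D der cont' pint, of 0]
      unfolding \<Gamma>_def g_def[abs_def] by auto
    ultimately show ?thesis
      unfolding Q_def by (intro tendsto_intros) simp_all
  qed
  ultimately have "g t - g 0 - (J t - J 0 + J t) = 0"
    by (intro tendsto_unique[of "at_right (0::real)"]) auto
  then show ?thesis
    by (simp add: g_def J_def j_def[abs_def])
qed

end

section \<open>The concavity argument\<close>

lemma nondecreasing_if_derivative_nonneg:
  fixes f :: "real \<Rightarrow> real"
  assumes "a \<le> b"
    and "\<And>x. x \<in> {a..b} \<Longrightarrow> (f has_real_derivative f' x) (at x within {a..b})"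
    and "\<And>x. x \<in> {a..b} \<Longrightarrow> 0 \<le> f' x"
  shows "f a \<le> f b"
  using \<open>a \<le> b\<close>
proof (rule nondecreasing_if_supported)
  fix x assume "a \<le> x" "x \<le> b"
  then show "\<exists>W D d. 0 \<le> D \<and> 0 < d \<and> (W has_real_derivative D) (at x within {a..b}) \<and> W x = f x \<and>
           (\<forall>y\<in>{a..b}. x \<le> y \<and> y < x + d \<longrightarrow> W y \<le> f y) \<and>
           (\<forall>y\<in>{a..b}. x - d < y \<and> y \<le> x \<longrightarrow> f y \<le> W y)"
    using assms(2,3)[of x] by (intro exI[of _ f] exI[of _ "f' x"] exI[of _ 1]) auto
qed

text \<open>
  If \<open>\<psi>' = 2 \<phi>\<close> and \<open>y = \<psi> powr (-\<alpha>)\<close>, then \<open>4 \<alpha>\<^sup>2\<close> times this quantity is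
  \<open>y'\<^sup>2 - 8 \<alpha>\<^sup>2 K y powr (2 + 1/\<alpha>)\<close>, the first integral of the equation
  \<open>y'' = 4 \<alpha> (1 + 2 \<alpha>) K y powr (1 + 1/\<alpha>)\<close>. Working with \<open>\<phi>\<close> in place of \<open>y'\<close> makes its monotonicity in
  \<open>\<phi>\<close> visible.
\<close>

definition levine :: "real \<Rightarrow> real \<Rightarrow> real \<Rightarrow> real \<Rightarrow> real" where
  "levine \<alpha> K \<phi> \<psi> = (\<phi>\<^sup>2 / \<psi> - 2 * K) * \<psi> powr (- (1 + 2 * \<alpha>))"

lemma levine_mono:
  assumes "0 \<le> \<phi>" "\<phi> \<le> \<phi>'" "0 < \<psi>"
  shows "levine \<alpha> K \<phi> \<psi> \<le> levine \<alpha> K \<phi>' \<psi>"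
  using assms unfolding levine_def
  by (intro mult_right_mono diff_right_mono divide_right_mono power_mono) auto

text \<open>
  The bracket compares the slope \<open>\<rho>\<close> of \<open>S\<close> with the lower bound that the growth estimate
  and the Cauchy-Schwarz inequality provide.
\<close>

lemma levine_has_derivative:
  assumes S: "(S has_real_derivative \<rho>) (at x within A)"
    and \<Psi>: "(\<Psi> has_real_derivative 2 * S x) (at x within A)"
    and pos: "0 < \<Psi> x"
  shows "((\<lambda>y. levine \<alpha> K (S y) (\<Psi> y)) has_real_derivative
     2 * \<Psi> x powr (- (1 + 2 * \<alpha>)) * (S x / \<Psi> x) *
       (\<rho> - (2 * (1 + \<alpha>) * (S x)\<^sup>2 / \<Psi> x - 2 * (1 + 2 * \<alpha>) * K))) (at x within A)"
proof -
  define q where "q = \<Psi> x powr (- (1 + 2 * \<alpha>))"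
  have "((\<lambda>y. \<Psi> y powr (- (1 + 2 * \<alpha>))) has_real_derivative
      - (1 + 2 * \<alpha>) * \<Psi> x powr (- (1 + 2 * \<alpha>) - 1) * (2 * S x)) (at x within A)"
    by (rule has_real_derivative_powr[THEN DERIV_chain2, OF pos \<Psi>])
  moreover have "\<Psi> x powr (- (1 + 2 * \<alpha>) - 1) = q / \<Psi> x"
    unfolding q_def using pos powr_diff[of "\<Psi> x" "- (1 + 2 * \<alpha>)" 1] by simp
  ultimately have pow: "((\<lambda>y. \<Psi> y powr (- (1 + 2 * \<alpha>))) has_real_derivative
      - (1 + 2 * \<alpha>) * (q / \<Psi> x) * (2 * S x)) (at x within A)"
    by simp
  have quot: "((\<lambda>y. (S y)\<^sup>2 / \<Psi> y - 2 * K) has_real_derivative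
      (2 * S x * \<rho> * \<Psi> x - (S x)\<^sup>2 * (2 * S x)) / (\<Psi> x * \<Psi> x)) (at x within A)"
    using pos by (auto intro!: derivative_eq_intros S \<Psi>)
  have "(2 * S x * \<rho> * \<Psi> x - (S x)\<^sup>2 * (2 * S x)) / (\<Psi> x * \<Psi> x) * q
      + - (1 + 2 * \<alpha>) * (q / \<Psi> x) * (2 * S x) * ((S x)\<^sup>2 / \<Psi> x - 2 * K)
    = 2 * q * (S x / \<Psi> x) * (\<rho> - (2 * (1 + \<alpha>) * (S x)\<^sup>2 / \<Psi> x - 2 * (1 + 2 * \<alpha>) * K))"
    using pos by (simp add: field_simps power2_eq_square)
  with DERIV_mult[OF quot pow] show ?thesis
    unfolding levine_def q_def[symmetric] by simp
qed

lemma levine_ge_imp: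
  assumes "\<zeta> \<le> levine \<alpha> K \<phi> \<psi>" "0 \<le> K" "0 < \<psi>"
  shows "\<zeta> * (\<psi> powr (1 + \<alpha>))\<^sup>2 \<le> \<phi>\<^sup>2"
proof -
  have "\<psi> powr (- (1 + 2 * \<alpha>)) * (\<psi> powr (1 + \<alpha>))\<^sup>2 = \<psi>"
    using assms(3) by (simp add: power2_eq_square flip: powr_add)
  then have "levine \<alpha> K \<phi> \<psi> * (\<psi> powr (1 + \<alpha>))\<^sup>2 = (\<phi>\<^sup>2 / \<psi> - 2 * K) * \<psi>"
    by (simp add: levine_def mult.assoc)
  also have "\<dots> \<le> \<phi>\<^sup>2"
    using assms(2,3) by (simp add: field_simps)
  finally show ?thesis
    using mult_right_mono[OF assms(1), of "(\<psi> powr (1 + \<alpha>))\<^sup>2"] by simp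
qed

text \<open>
  The function \<open>\<Phi>\<close> is only known to grow at least as fast as an indefinite integral. At
  a point \<open>x\<close> it is therefore compared with the differentiable function \<open>S\<close> that has this
  integral as its increment: \<open>S \<le> \<Phi>\<close> to the right of \<open>x\<close> and \<open>\<Phi> \<le> S\<close> to the left. By monotonicity
  of \<open>levine\<close> in \<open>\<phi>\<close>, \<open>nondecreasing_if_supported\<close> applies while \<open>\<Phi> > 0\<close>. At a
  first zero \<open>\<Phi>\<close> would have to pass through small positive values, which the resulting lower bound
  \<open>\<Phi> \<ge> sqrt \<zeta> * \<Psi> powr (1 + \<alpha>)\<close> excludes.
\<close>

lemma concavity_blow_up_time:
  fixes \<Psi> \<Phi> p :: "real \<Rightarrow> real"
  assumes \<alpha>: "\<alpha> > 0" and K: "0 \<le> K" and b: "0 \<le> b"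
    and der\<Psi>: "\<And>t. t \<in> {0..b} \<Longrightarrow> (\<Psi> has_real_derivative 2 * \<Phi> t) (at t within {0..b})"
    and cont\<Phi>: "continuous_on {0..b} \<Phi>" and contp: "continuous_on {0..b} p"
    and CS: "\<And>t. t \<in> {0..b} \<Longrightarrow> (\<Phi> t)\<^sup>2 \<le> \<Psi> t * p t"
    and growth: "\<And>s t. 0 \<le> s \<Longrightarrow> s \<le> t \<Longrightarrow> t \<le> b \<Longrightarrow>
        integral {s..t} (\<lambda>r. 2 * (1 + \<alpha>) * p r - 2 * (1 + 2 * \<alpha>) * K) \<le> \<Phi> t - \<Phi> s"
    and init: "0 < \<Phi> 0" "0 < \<Psi> 0" "2 * K < (\<Phi> 0)\<^sup>2 / \<Psi> 0"
  shows "\<forall>t\<in>{0..b}. 0 < \<Phi> t"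
    and "2 * \<alpha> * sqrt (levine \<alpha> K (\<Phi> 0) (\<Psi> 0)) * b < \<Psi> 0 powr (- \<alpha>)"
proof -
  define R where "R r = 2 * (1 + \<alpha>) * p r - 2 * (1 + 2 * \<alpha>) * K" for r
  define \<zeta> where "\<zeta> = levine \<alpha> K (\<Phi> 0) (\<Psi> 0)"
  have "\<zeta> > 0"
    using init unfolding \<zeta>_def levine_def by (intro mult_pos_pos) auto
  have contR: "continuous_on {0..b} R"
    unfolding R_def by (intro continuous_intros contp)
  have \<Psi>_ge: "\<Psi> 0 \<le> \<Psi> d" if d: "0 \<le> d" "d \<le> b" and pos: "\<And>t. t \<in> {0..d} \<Longrightarrow> 0 < \<Phi> t" for d
  proof (rule nondecreasing_if_derivative_nonneg[OF d(1)])
    show "(\<Psi> has_real_derivative 2 * \<Phi> x) (at x within {0..d})" if "x \<in> {0..d}" for x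
      using that d by (intro DERIV_subset[OF der\<Psi>]) auto
  qed (use pos in \<open>auto simp: less_imp_le\<close>)
  have levine_ge: "\<zeta> \<le> levine \<alpha> K (\<Phi> d) (\<Psi> d)"
    if d: "0 \<le> d" "d \<le> b" and pos: "\<And>t. t \<in> {0..d} \<Longrightarrow> 0 < \<Phi> t" for d
    unfolding \<zeta>_def using d(1)
  proof (rule nondecreasing_if_supported[where Z="\<lambda>t. levine \<alpha> K (\<Phi> t) (\<Psi> t)"])
    have \<Psi>pos: "0 < \<Psi> y" if "y \<in> {0..d}" for y
      using \<Psi>_ge[of y] pos that d init by force
    fix x assume x: "0 \<le> x" "x \<le> d"
    \<comment> \<open>The comparison function that touches \<open>\<Phi>\<close> at \<open>x\<close>.\<close>
    define S where "S y = \<Phi> x + (integral {0..y} R - integral {0..x} R)" for y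
    have Sx: "S x = \<Phi> x" by (simp add: S_def)
    have "((\<lambda>y. integral {0..y} R) has_real_derivative R x) (at x within {0..d})"
      using x d contR by (intro integral_has_real_derivative) (auto intro: continuous_on_subset)
    then have derS: "(S has_real_derivative R x) (at x within {0..d})"
      unfolding S_def by (auto intro!: derivative_eq_intros)
    have "(S \<longlongrightarrow> S x) (at x within {0..d})"
      using DERIV_continuous[OF derS] by (simp add: continuous_within)
    then have "eventually (\<lambda>y. 0 < S y) (at x within {0..d})"
      using pos[of x] x Sx by (intro order_tendstoD) auto
    then obtain e where e: "e > 0" "\<And>y. y \<in> {0..d} \<Longrightarrow> y \<noteq> x \<Longrightarrow> dist y x < e \<Longrightarrow> 0 < S y"
      unfolding eventually_at by auto
    have Spos: "0 < S y" if "y \<in> {0..d}" "\<bar>y - x\<bar> < e" for y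
      using e(2)[of y] that pos[of x] x Sx by (cases "y = x") (auto simp: dist_real_def)
    have below: "integral {0..t} R - integral {0..s} R \<le> \<Phi> t - \<Phi> s" if "0 \<le> s" "s \<le> t" "t \<le> b" for s t
      using growth[OF that] integral_increment(1)[OF integrable_continuous_real[OF contR] that]
      by (simp add: R_def[abs_def])
    let ?D = "2 * \<Psi> x powr (- (1 + 2 * \<alpha>)) * (S x / \<Psi> x) *
       (R x - (2 * (1 + \<alpha>) * (S x)\<^sup>2 / \<Psi> x - 2 * (1 + 2 * \<alpha>) * K))"
    show "\<exists>W D d'. 0 \<le> D \<and> 0 < d' \<and> (W has_real_derivative D) (at x within {0..d}) \<and>
           W x = levine \<alpha> K (\<Phi> x) (\<Psi> x) \<and>
           (\<forall>y\<in>{0..d}. x \<le> y \<and> y < x + d' \<longrightarrow> W y \<le> levine \<alpha> K (\<Phi> y) (\<Psi> y)) \<and>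
           (\<forall>y\<in>{0..d}. x - d' < y \<and> y \<le> x \<longrightarrow> levine \<alpha> K (\<Phi> y) (\<Psi> y) \<le> W y)"
    proof (rule exI[of _ "\<lambda>y. levine \<alpha> K (S y) (\<Psi> y)"], rule exI[of _ ?D], rule exI[of _ e],
        intro conjI ballI impI)
      have "(\<Phi> x)\<^sup>2 / \<Psi> x \<le> p x"
        using CS[of x] \<Psi>pos[of x] x d by (simp add: field_simps)
      then have "2 * (1 + \<alpha>) * ((\<Phi> x)\<^sup>2 / \<Psi> x) \<le> 2 * (1 + \<alpha>) * p x"
        using \<alpha> by (intro mult_left_mono) auto
      then show "0 \<le> ?D"
        using pos[of x] \<Psi>pos[of x] x by (simp add: Sx R_def)
      show "((\<lambda>y. levine \<alpha> K (S y) (\<Psi> y)) has_real_derivative ?D) (at x within {0..d})"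
      proof (rule levine_has_derivative[OF derS])
        show "(\<Psi> has_real_derivative 2 * S x) (at x within {0..d})"
          unfolding Sx using x d by (intro DERIV_subset[OF der\<Psi>]) auto
      qed (use \<Psi>pos[of x] x in auto)
      show "levine \<alpha> K (S y) (\<Psi> y) \<le> levine \<alpha> K (\<Phi> y) (\<Psi> y)"
        if "y \<in> {0..d}" "x \<le> y \<and> y < x + e" for y
        using that below[of x y] x d Spos[of y] \<Psi>pos[of y] by (intro levine_mono) (auto simp: S_def)
      show "levine \<alpha> K (\<Phi> y) (\<Psi> y) \<le> levine \<alpha> K (S y) (\<Psi> y)"
        if "y \<in> {0..d}" "x - e < y \<and> y \<le> x" for y
        using that below[of y x] x d pos[of y] \<Psi>pos[of y] by (intro levine_mono) (auto simp: S_def less_imp_le)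
    qed (use e Sx in auto)
  qed
  have \<Phi>_ge: "sqrt \<zeta> * \<Psi> d powr (1 + \<alpha>) \<le> \<Phi> d"
    if d: "0 \<le> d" "d \<le> b" and pos: "\<And>t. t \<in> {0..d} \<Longrightarrow> 0 < \<Phi> t" for d
  proof -
    have "0 < \<Psi> d" using \<Psi>_ge[OF d pos] init by auto
    from levine_ge_imp[OF levine_ge[OF d pos] K this]
    have "(sqrt \<zeta> * \<Psi> d powr (1 + \<alpha>))\<^sup>2 \<le> (\<Phi> d)\<^sup>2"
      using \<open>\<zeta> > 0\<close> by (simp add: power_mult_distrib)
    then show ?thesis
      by (rule power2_le_imp_le) (use pos[of d] d in auto)
  qed
  show pos: "\<forall>t\<in>{0..b}. 0 < \<Phi> t"
  proof (rule ccontr)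
    assume "\<not> (\<forall>t\<in>{0..b}. 0 < \<Phi> t)"
    then have ne: "{t \<in> {0..b}. \<Phi> t \<le> 0} \<noteq> {}" by (auto simp: not_less)
    have "closed {t \<in> {0..b}. \<Phi> t \<le> 0}"
      by (intro continuous_on_closed_Collect_le cont\<Phi>) auto
    then have "compact {t \<in> {0..b}. \<Phi> t \<le> 0}"
      by (auto simp: compact_eq_bounded_closed intro: bounded_subset[of "{0..b}"])
    then obtain \<tau> where \<tau>: "\<tau> \<in> {0..b}" "\<Phi> \<tau> \<le> 0"
      and first: "\<And>t. t \<in> {0..b} \<Longrightarrow> \<Phi> t \<le> 0 \<Longrightarrow> \<tau> \<le> t"
      using compact_attains_inf[OF _ ne] by auto
    \<comment> \<open>A value below the a priori bound that \<open>\<Phi>\<close> takes before its first zero \<open>\<tau>\<close>.\<close>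
    define y where "y = min (\<Phi> 0) (sqrt \<zeta> * \<Psi> 0 powr (1 + \<alpha>)) / 2"
    have y: "0 < y" "y \<le> \<Phi> 0" "y < sqrt \<zeta> * \<Psi> 0 powr (1 + \<alpha>)"
    proof -
      have "0 < sqrt \<zeta> * \<Psi> 0 powr (1 + \<alpha>)" using init \<open>\<zeta> > 0\<close> by simp
      then show "0 < y" "y \<le> \<Phi> 0" "y < sqrt \<zeta> * \<Psi> 0 powr (1 + \<alpha>)"
        using init(1) unfolding y_def by (auto simp: min_def)
    qed
    obtain d where d: "0 \<le> d" "d \<le> \<tau>" "\<Phi> d = y"
      using IVT2'[of \<Phi> \<tau> y 0] \<tau> y continuous_on_subset[OF cont\<Phi>, of "{0..\<tau>}"] by auto
    then have "d < \<tau>" using \<tau> y by (cases "d = \<tau>") auto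
    then have "0 < \<Phi> t" if "t \<in> {0..d}" for t
      using first[of t] that \<tau> by force
    note * = this
    have "\<Psi> 0 powr (1 + \<alpha>) \<le> \<Psi> d powr (1 + \<alpha>)"
      using \<Psi>_ge[of d] * d \<tau> init \<alpha> by (intro powr_mono2) auto
    then have "sqrt \<zeta> * \<Psi> 0 powr (1 + \<alpha>) \<le> sqrt \<zeta> * \<Psi> d powr (1 + \<alpha>)"
      using \<open>\<zeta> > 0\<close> by (intro mult_left_mono) auto
    also have "\<dots> \<le> \<Phi> d" using \<Phi>_ge[of d] * d \<tau> by auto
    finally show False using d y by simp
  qed
  \<comment> \<open>\<open>\<Psi> powr (-\<alpha>)\<close> decreases at least at the rate \<open>2 * \<alpha> * sqrt \<zeta>\<close>.\<close>
  define V where "V t = - (\<Psi> t powr (- \<alpha>)) - 2 * \<alpha> * sqrt \<zeta> * t" for t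
  have "V 0 \<le> V b"
  proof (rule nondecreasing_if_derivative_nonneg[OF b])
    fix x assume x: "x \<in> {0..b}"
    have \<Psi>pos: "0 < \<Psi> x" using \<Psi>_ge[of x] pos x init by force
    show "(V has_real_derivative 2 * \<alpha> * (\<Phi> x * \<Psi> x powr (- \<alpha> - 1) - sqrt \<zeta>)) (at x within {0..b})"
      unfolding V_def
      by (rule derivative_eq_intros der\<Psi>[OF x] refl \<Psi>pos)+ (simp add: algebra_simps)
    have "sqrt \<zeta> = sqrt \<zeta> * \<Psi> x powr (1 + \<alpha>) * \<Psi> x powr (- \<alpha> - 1)"
      using \<Psi>pos by (simp add: mult.assoc flip: powr_add)
    also have "\<dots> \<le> \<Phi> x * \<Psi> x powr (- \<alpha> - 1)"
      using \<Phi>_ge[of x] pos x by (intro mult_right_mono) auto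
    finally show "0 \<le> 2 * \<alpha> * (\<Phi> x * \<Psi> x powr (- \<alpha> - 1) - sqrt \<zeta>)"
      using \<alpha> by simp
  qed
  moreover have "0 < \<Psi> b powr (- \<alpha>)"
    using \<Psi>_ge[of b] pos b init by force
  ultimately show "2 * \<alpha> * sqrt (levine \<alpha> K (\<Phi> 0) (\<Psi> 0)) * b < \<Psi> 0 powr (- \<alpha>)"
    unfolding V_def \<zeta>_def[symmetric] by linarith
qed

section \<open>Strong solutions\<close>

lemma has_integral_le_off_negligible:
  fixes f g :: "real \<Rightarrow> real"
  assumes "(f has_integral i) S" "(g has_integral j) S" "negligible N"
    and le: "\<And>x. x \<in> S - N \<Longrightarrow> f x \<le> g x"
  shows "i \<le> j"
proof (rule has_integral_le)
  show "((\<lambda>x. if x \<in> N then 0 else f x) has_integral i) S"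
    by (rule has_integral_spike[OF assms(3) _ assms(1)]) auto
  show "((\<lambda>x. if x \<in> N then 0 else g x) has_integral j) S"
    by (rule has_integral_spike[OF assms(3) _ assms(2)]) auto
qed (use le in auto)

lemma form_cauchy_schwarz:
  assumes "subspace D" "linear_operator_on D P" "symmetric_on D P" "positive_definite_on D P"
    and v: "v \<in> D" and w: "w \<in> D"
  shows "(inner (P v) w)\<^sup>2 \<le> inner (P v) v * inner (P w) w"
proof (cases "v = 0")
  case True
  then have "inner (P v) w = inner v (P w)"
    using assms(3) v w unfolding symmetric_on_def by blast
  then show ?thesis
    using True by simp
next
  case False
  define a where "a = inner (P v) v"
  define c where "c = inner (P v) w"
  have a: "a > 0" using assms False by (simp add: a_def positive_definite_on_def)
  define z where "z = w + (- (c / a)) *\<^sub>R v"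
  have sv: "(- (c / a)) *\<^sub>R v \<in> D"
    using assms(1) v by (rule subspace_scale)
  have z: "z \<in> D"
    unfolding z_def using assms(1) w sv by (rule subspace_add)
  have Pz: "P z = P w + (- (c / a)) *\<^sub>R P v"
  proof -
    have "P z = P w + P ((- (c / a)) *\<^sub>R v)"
      using assms(2) w sv unfolding z_def linear_operator_on_def by blast
    also have "P ((- (c / a)) *\<^sub>R v) = (- (c / a)) *\<^sub>R P v"
      using assms(2) v unfolding linear_operator_on_def by blast
    finally show ?thesis .
  qed
  have "inner (P w) v = inner w (P v)"
    using assms(3) v w unfolding symmetric_on_def by blast
  then have "inner (P w) v = c"
    by (simp add: c_def inner_commute)
  have "inner (P z) z = inner (P w + (- (c / a)) *\<^sub>R P v) (w + (- (c / a)) *\<^sub>R v)"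
    by (subst Pz) (simp only: z_def)
  also have "\<dots> = inner (P w) w - 2 * (c / a) * c + (c / a)\<^sup>2 * a"
    using \<open>inner (P w) v = c\<close>
    by (simp add: inner_add_left inner_add_right power2_eq_square algebra_simps a_def[symmetric] c_def[symmetric])
  also have "\<dots> = inner (P w) w - c\<^sup>2 / a"
    using a by (simp add: field_simps power2_eq_square)
  finally have "inner (P z) z = inner (P w) w - c\<^sup>2 / a" .
  moreover have "0 \<le> inner (P z) z"
    using assms(4) z by (cases "z = 0") (auto simp: positive_definite_on_def less_imp_le)
  ultimately have "c\<^sup>2 / a \<le> inner (P w) w" by simp
  then show ?thesis
    using a by (simp add: pos_divide_le_eq mult.commute flip: a_def c_def)
qed

lemma strong_solution_equation_off_negligible:
  assumes "strong_solution_derivs D P A F S u u' u''" "b < S"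
  obtains N where "negligible N"
    "\<And>r. r \<in> {0..b} - N \<Longrightarrow> u'' r \<in> D \<and> P (u'' r) + A (u r) = F (u r)"
proof -
  have "AE t in lebesgue_on {0<..<S}. u'' t \<in> D \<and> P (u'' t) + A (u t) = F (u t)"
    using assms(1) by (simp add: strong_solution_derivs_def)
  then have "AE t in lebesgue. t \<in> {0<..<S} \<longrightarrow> u'' t \<in> D \<and> P (u'' t) + A (u t) = F (u t)"
    by (subst (asm) AE_restrict_space_iff) auto
  then obtain N where N: "negligible N"
    "{t. \<not> (t \<in> {0<..<S} \<longrightarrow> u'' t \<in> D \<and> P (u'' t) + A (u t) = F (u t))} \<subseteq> N"
    unfolding eventually_ae_filter_negligible by blast
  show thesis
  proof (rule that)
    show "negligible (insert 0 N)" using N(1) by (simp add: negligible_insert)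
    fix r assume "r \<in> {0..b} - insert 0 N"
    then have "r \<in> {0<..<S}" "r \<notin> N" using assms(2) by auto
    then show "u'' r \<in> D \<and> P (u'' r) + A (u r) = F (u r)" using N(2) by blast
  qed
qed

lemma strong_solution_on_Icc:
  assumes sol: "strong_solution_derivs D P A F S u u' u''" and "b < S"
  shows "\<And>t. t \<in> {0..b} \<Longrightarrow> u t \<in> D" "\<And>t. t \<in> {0..b} \<Longrightarrow> u' t \<in> D"
    and "continuous_on {0..b} u" "continuous_on {0..b} u'"
    and "\<And>t. t \<in> {0..b} \<Longrightarrow> (u has_vector_derivative u' t) (at t within {0..b})"
proof -
  have sub: "{0..b} \<subseteq> {0..<S}" using \<open>b < S\<close> by auto
  have "\<forall>t\<in>{0..<S}. u t \<in> D \<and> u' t \<in> D" "continuous_on {0..<S} u" "continuous_on {0..<S} u'"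
    "\<forall>t\<in>{0..<S}. (u has_vector_derivative u' t) (at t within {0..<S})"
    using sol unfolding strong_solution_derivs_def by blast+
  then show "\<And>t. t \<in> {0..b} \<Longrightarrow> u t \<in> D" "\<And>t. t \<in> {0..b} \<Longrightarrow> u' t \<in> D"
    "continuous_on {0..b} u" "continuous_on {0..b} u'"
    "\<And>t. t \<in> {0..b} \<Longrightarrow> (u has_vector_derivative u' t) (at t within {0..b})"
    using sub has_vector_derivative_within_subset[OF _ sub] continuous_on_subset[OF _ sub] by blast+
qed

text \<open>
  The first part makes \<open>P u_t\<close> continuous; this continuity is what makes \<open>u_t\<close> an admissible
  density of \<open>u\<close> in the second part.
\<close>

lemma strong_solution_curves:
  assumes dense: "closure D = UNIV" and sym: "symmetric_on D P"
    and sol: "strong_solution_derivs D P A F S u u' u''" and b: "0 \<le> b" "b < S"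
  shows "symmetric_densely_defined.curve_with_density D P b u' u''"
    and "symmetric_densely_defined.curve_with_density D P b u u'"
proof -
  interpret symmetric_densely_defined D P using dense sym by unfold_locales
  note vals = strong_solution_on_Icc(1,2)[OF sol b(2)]
  note cont = strong_solution_on_Icc(3,4)[OF sol b(2)]
  note der = strong_solution_on_Icc(5)[OF sol b(2)]
  obtain N where N: "negligible N" "\<And>r. r \<in> {0..b} - N \<Longrightarrow> u'' r \<in> D \<and> P (u'' r) + A (u r) = F (u r)"
    using strong_solution_equation_off_negligible[OF sol b(2)] by blast
  show c1: "curve_with_density b u' u''"
    unfolding curve_with_density_def
  proof (intro conjI ballI allI)
    show "\<exists>N. negligible N \<and> (\<forall>r\<in>{0..b} - N. u'' r \<in> D)" using N by blast
    show "(\<lambda>r. P (u'' r)) pairing_integrable_on {0..b}"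
      using sol b by (intro L2_on_imp_pairing_integrable) (auto simp: strong_solution_derivs_def)
    fix x t assume "t \<in> {0..b}"
    then have "(u'' has_integral (u' t - u' 0)) {0..t}"
      using sol b by (auto simp: strong_solution_derivs_def)
    from has_integral_linear[OF this bounded_linear_inner_left[of x]]
    show "((\<lambda>r. inner (u'' r) x) has_integral inner (u' t - u' 0) x) {0..t}"
      by (simp add: o_def)
  qed (use vals cont in auto)
  show "curve_with_density b u u'"
    unfolding curve_with_density_def
  proof (intro conjI ballI allI)
    show "\<exists>N. negligible N \<and> (\<forall>r\<in>{0..b} - N. u' r \<in> D)" using vals by (intro exI[of _ "{}"]) auto
    show "(\<lambda>r. P (u' r)) pairing_integrable_on {0..b}"
      by (intro continuous_imp_pairing_integrable continuous_on_image[OF c1])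
    fix x t assume t: "t \<in> {0..b}"
    have "((\<lambda>r. inner (u' r) x) has_integral inner (u t) x - inner (u 0) x) {0..t}"
    proof (rule fundamental_theorem_of_calculus)
      show "((\<lambda>r. inner (u r) x) has_vector_derivative inner (u' r) x) (at r within {0..t})"
        if "r \<in> {0..t}" for r
        using that t
        by (intro bounded_linear.has_vector_derivative[OF bounded_linear_inner_left]
            has_vector_derivative_within_subset[OF der]) auto
    qed (use t in auto)
    then show "((\<lambda>r. inner (u' r) x) has_integral inner (u t - u 0) x) {0..t}"
      by (simp add: inner_diff_left)
  qed (use vals cont in auto)
qed

text \<open>
  The three terms change by the integrals of \<open>(P u_tt, u_t)\<close>, \<open>(A u, u_t)\<close> and \<open>(F(u), u_t)\<close>, by
  the product rule for \<open>P\<close>, by \<open>form_increment\<close> for \<open>A\<close> and by the chain rule for the potential. The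
  equation, paired with \<open>u_t\<close>, makes the sum of the integrands vanish almost everywhere.
\<close>

lemma energy_conservation:
  assumes dense: "closure D = UNIV" and symP: "symmetric_on D P" and symA: "symmetric_on D A"
    and chain: "potential_chain_rule D P A F G"
    and sol: "strong_solution_derivs D P A F S u u' u''" and t: "0 \<le> t" "t < S"
  shows "1/2 * inner (P (u' t)) (u' t) + 1/2 * inner (A (u t)) (u t) - G (u t)
       = 1/2 * inner (P (u' 0)) (u' 0) + 1/2 * inner (A (u 0)) (u 0) - G (u 0)"
proof -
  interpret P: symmetric_densely_defined D P using dense symP by unfold_locales
  interpret A: symmetric_densely_defined D A using dense symA by unfold_locales
  \<comment> \<open>The averaging in \<open>form_increment\<close> needs some room to the right of \<open>t\<close>.\<close>
  define b where "b = (t + S) / 2"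
  have b: "0 \<le> b" "t < b" "b < S" using t by (auto simp: b_def)
  obtain N where N: "negligible N" "\<And>r. r \<in> {0..b} - N \<Longrightarrow> u'' r \<in> D \<and> P (u'' r) + A (u r) = F (u r)"
    using strong_solution_equation_off_negligible[OF sol b(3)] by blast
  note vals = strong_solution_on_Icc(1,2)[OF sol b(3)]
  note cont' = strong_solution_on_Icc(4)[OF sol b(3)]
  note der = strong_solution_on_Icc(5)[OF sol b(3)]
  have pintA: "(\<lambda>r. A (u r)) pairing_integrable_on {0..b}"
    using sol b by (intro L2_on_imp_pairing_integrable) (auto simp: strong_solution_derivs_def)
  have "((\<lambda>r. inner (P (u'' r)) (u' r) + inner (u' r) (P (u'' r))) has_integral
      inner (P (u' t)) (u' t) - inner (P (u' 0)) (u' 0)) {0..t}"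
    using P.product_rule[OF strong_solution_curves(1,1)[OF dense symP sol b(1,3)], of 0 t] t b by auto
  from has_integral_mult_right[OF this, of "1/2"]
  have kin: "((\<lambda>r. inner (P (u'' r)) (u' r)) has_integral
      1/2 * (inner (P (u' t)) (u' t) - inner (P (u' 0)) (u' 0))) {0..t}"
    by (simp add: inner_commute)
  have "(\<lambda>r. inner (A (u r)) (u' r)) integrable_on {0..t}"
    using pairing_integrable_on_subinterval(2)[OF pintA, of 0 t u'] cont' b by auto
  moreover have "integral {0..t} (\<lambda>r. inner (A (u r)) (u' r))
      = 1/2 * (inner (A (u t)) (u t) - inner (A (u 0)) (u 0))"
    using A.form_increment[OF vals(1) der cont' pintA, of t] t b by simp
  ultimately have pot: "((\<lambda>r. inner (A (u r)) (u' r)) has_integral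
      1/2 * (inner (A (u t)) (u t) - inner (A (u 0)) (u 0))) {0..t}"
    by (simp add: has_integral_iff)
  have src: "((\<lambda>r. inner (F (u r)) (u' r)) has_integral G (u t) - G (u 0)) {0..t}"
    using chain[unfolded potential_chain_rule_def, rule_format, OF sol, of t] t by simp
  have "((\<lambda>r. inner (P (u'' r)) (u' r) + inner (A (u r)) (u' r) - inner (F (u r)) (u' r)) has_integral
      1/2 * (inner (P (u' t)) (u' t) - inner (P (u' 0)) (u' 0))
      + 1/2 * (inner (A (u t)) (u t) - inner (A (u 0)) (u 0)) - (G (u t) - G (u 0))) {0..t}"
    by (intro has_integral_diff has_integral_add kin pot src)
  moreover have "((\<lambda>r. inner (P (u'' r)) (u' r) + inner (A (u r)) (u' r) - inner (F (u r)) (u' r))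
      has_integral 0) {0..t}"
  proof (rule has_integral_spike[OF N(1) _ has_integral_0])
    fix r assume "r \<in> {0..t} - N"
    then have "P (u'' r) + A (u r) = F (u r)" using N(2)[of r] b by auto
    then show "inner (P (u'' r)) (u' r) + inner (A (u r)) (u' r) - inner (F (u r)) (u' r) = 0"
      by (metis inner_add_left diff_self)
  qed
  ultimately have "1/2 * (inner (P (u' t)) (u' t) - inner (P (u' 0)) (u' 0))
      + 1/2 * (inner (A (u t)) (u t) - inner (A (u 0)) (u 0)) - (G (u t) - G (u 0)) = 0"
    by (rule has_integral_unique)
  then show ?thesis by (simp add: algebra_simps)
qed

text \<open>
  The bound on \<open>b\<close> involves the initial data only, hence limits the life time of every strong
  solution with these data. The energy enters only through an upper bound \<open>K \<ge> 0\<close>, because the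
  concavity argument needs a nonnegative constant.
\<close>

lemma strong_solution_blow_up_bound:
  fixes D :: "'a::{real_inner, complete_space} set"
  assumes sub: "subspace D" and dense: "closure D = UNIV"
    and linP: "linear_operator_on D P" and symP: "symmetric_on D P" and posP: "positive_definite_on D P"
    and symA: "symmetric_on D A" and posA: "positive_definite_on D A"
    and chain: "potential_chain_rule D P A F G"
    and \<alpha>: "\<alpha> > 0"
    and FG: "\<And>v. v \<in> D \<Longrightarrow> 2 * (1 + 2 * \<alpha>) * G v - 2 * R0 \<le> inner (F v) v"
    and sol: "strong_solution_derivs D P A F S u u' u''"
    and K0: "0 \<le> K"
    and K: "1/2 * inner (P (u' 0)) (u' 0) + 1/2 * inner (A (u 0)) (u 0) - G (u 0) + R0 / (1 + 2 * \<alpha>) \<le> K"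
    and init: "0 < inner (P (u 0)) (u' 0)" "0 < inner (P (u 0)) (u 0)"
      "2 * K < (inner (P (u 0)) (u' 0))\<^sup>2 / inner (P (u 0)) (u 0)"
    and b: "0 \<le> b" "b < S"
  shows "\<And>s. 0 \<le> s \<Longrightarrow> s \<le> b \<Longrightarrow> inner (P (u s)) (u s) \<le> inner (P (u b)) (u b)"
    and "2 * \<alpha> * sqrt (levine \<alpha> K (inner (P (u 0)) (u' 0)) (inner (P (u 0)) (u 0))) * b
           < inner (P (u 0)) (u 0) powr (- \<alpha>)"
proof -
  interpret symmetric_densely_defined D P using dense symP by unfold_locales
  define \<Psi> where "\<Psi> t = inner (P (u t)) (u t)" for t
  define \<Phi> where "\<Phi> t = inner (P (u t)) (u' t)" for t
  define p where "p t = inner (P (u' t)) (u' t)" for t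
  define g where "g t = inner (A (u t)) (u t)" for t
  obtain N where N: "negligible N" "\<And>r. r \<in> {0..b} - N \<Longrightarrow> u'' r \<in> D \<and> P (u'' r) + A (u r) = F (u r)"
    using strong_solution_equation_off_negligible[OF sol b(2)] by blast
  note vals = strong_solution_on_Icc(1,2)[OF sol b(2)]
  note cont = strong_solution_on_Icc(3,4)[OF sol b(2)]
  note c1 = strong_solution_curves(1)[OF dense symP sol b]
  note c0 = strong_solution_curves(2)[OF dense symP sol b]
  have cont\<Phi>: "continuous_on {0..b} \<Phi>" and contp: "continuous_on {0..b} p"
    unfolding \<Phi>_def p_def
    by (rule continuous_on_inner[OF continuous_on_image[OF c0] cont(2)]
        continuous_on_inner[OF continuous_on_image[OF c1] cont(2)])+
  have der\<Psi>: "(\<Psi> has_real_derivative 2 * \<Phi> t) (at t within {0..b})" if t: "t \<in> {0..b}" for t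
  proof -
    have eq: "\<Psi> x = \<Psi> 0 + integral {0..x} (\<lambda>r. 2 * \<Phi> r)" if x: "x \<in> {0..b}" for x
    proof -
      have "((\<lambda>r. inner (P (u' r)) (u r) + inner (u r) (P (u' r))) has_integral \<Psi> x - \<Psi> 0) {0..x}"
        unfolding \<Psi>_def using x by (intro product_rule[OF c0 c0]) auto
      moreover have "inner (P (u' r)) (u r) + inner (u r) (P (u' r)) = 2 * \<Phi> r" if "r \<in> {0..x}" for r
        using inner_swap[of "u r" "u' r"] vals[of r] that x by (simp add: \<Phi>_def inner_commute)
      ultimately have "((\<lambda>r. 2 * \<Phi> r) has_integral \<Psi> x - \<Psi> 0) {0..x}"
        by (rule has_integral_eq[rotated])
      from integral_unique[OF this] show ?thesis by linarith
    qed
    have "((\<lambda>x. \<Psi> 0 + integral {0..x} (\<lambda>r. 2 * \<Phi> r)) has_real_derivative 0 + 2 * \<Phi> t) (at t within {0..b})"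
      by (intro DERIV_add DERIV_const integral_has_real_derivative t continuous_intros cont\<Phi>)
    then have "(\<Psi> has_real_derivative 0 + 2 * \<Phi> t) (at t within {0..b})"
      by (rule has_field_derivative_transform_within[OF _ zero_less_one t]) (rule eq[symmetric])
    then show ?thesis by simp
  qed
  have CS: "(\<Phi> t)\<^sup>2 \<le> \<Psi> t * p t" if "t \<in> {0..b}" for t
    unfolding \<Phi>_def \<Psi>_def p_def
    by (rule form_cauchy_schwarz[OF sub linP symP posP vals(1)[OF that] vals(2)[OF that]])
  have growth: "integral {s..t} (\<lambda>r. 2 * (1 + \<alpha>) * p r - 2 * (1 + 2 * \<alpha>) * K) \<le> \<Phi> t - \<Phi> s"
    if st: "0 \<le> s" "s \<le> t" "t \<le> b" for s t
  proof (rule has_integral_le_off_negligible[OF _ _ N(1)])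
    have "continuous_on {s..t} (\<lambda>r. 2 * (1 + \<alpha>) * p r - 2 * (1 + 2 * \<alpha>) * K)"
      using continuous_on_subset[OF contp, of "{s..t}"] st by (auto intro!: continuous_intros)
    then show "((\<lambda>r. 2 * (1 + \<alpha>) * p r - 2 * (1 + 2 * \<alpha>) * K) has_integral
        integral {s..t} (\<lambda>r. 2 * (1 + \<alpha>) * p r - 2 * (1 + 2 * \<alpha>) * K)) {s..t}"
      by (intro integrable_integral integrable_continuous_real)
    have "\<Phi> r = inner (P (u' r)) (u r)" if "r \<in> {0..b}" for r
      using inner_swap[of "u r" "u' r"] vals[of r] that by (simp add: \<Phi>_def inner_commute)
    then show "((\<lambda>r. inner (P (u'' r)) (u r) + inner (u' r) (P (u' r))) has_integral \<Phi> t - \<Phi> s) {s..t}"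
      using product_rule[OF c1 c0 st] st by (metis (no_types, lifting) atLeastAtMost_iff order_trans)
    fix r assume r: "r \<in> {s..t} - N"
    then have rb: "r \<in> {0..b}" using st by auto
    have "P (u'' r) = F (u r) - A (u r)"
      using N(2)[of r] r rb by (auto simp: algebra_simps)
    then have eq: "inner (P (u'' r)) (u r) = inner (F (u r)) (u r) - g r"
      by (simp add: g_def inner_diff_left)
    have F: "2 * (1 + 2 * \<alpha>) * G (u r) - 2 * R0 \<le> inner (F (u r)) (u r)"
      using FG vals(1)[OF rb] .
    define \<kappa> where "\<kappa> = R0 / (1 + 2 * \<alpha>)"
    have \<kappa>: "(1 + 2 * \<alpha>) * \<kappa> = R0"
      using \<alpha> by (simp add: \<kappa>_def)
    have "1/2 * p r + 1/2 * g r + \<kappa> - K \<le> G (u r)"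
      using energy_conservation[OF dense symP symA chain sol, of r] K rb b
      unfolding p_def g_def \<kappa>_def by auto
    then have "(1 + 2 * \<alpha>) * (p r + g r + 2 * \<kappa> - 2 * K) \<le> (1 + 2 * \<alpha>) * (2 * G (u r))"
      using \<alpha> by (intro mult_left_mono) auto
    then have E: "(1 + 2 * \<alpha>) * (p r + g r) + 2 * R0 - 2 * (1 + 2 * \<alpha>) * K \<le> 2 * (1 + 2 * \<alpha>) * G (u r)"
      unfolding \<kappa>[symmetric] by (simp add: algebra_simps)
    have "0 \<le> g r"
      using posA vals(1)[OF rb] unfolding g_def positive_definite_on_def
      by (cases "u r = 0") (auto simp: less_imp_le)
    then have "0 \<le> 2 * \<alpha> * g r" using \<alpha> by simp
    then have "2 * (1 + \<alpha>) * p r - 2 * (1 + 2 * \<alpha>) * K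
        \<le> (1 + 2 * \<alpha>) * (p r + g r) - 2 * (1 + 2 * \<alpha>) * K - g r + p r"
      by (simp add: algebra_simps)
    moreover have "inner (u' r) (P (u' r)) = p r" by (simp add: p_def inner_commute)
    ultimately show "2 * (1 + \<alpha>) * p r - 2 * (1 + 2 * \<alpha>) * K
        \<le> inner (P (u'' r)) (u r) + inner (u' r) (P (u' r))"
      using eq F E by linarith
  qed
  note blow = concavity_blow_up_time[OF \<alpha> K0 b(1) der\<Psi> cont\<Phi> contp CS growth init[folded \<Phi>_def \<Psi>_def]]
  show "2 * \<alpha> * sqrt (levine \<alpha> K (inner (P (u 0)) (u' 0)) (inner (P (u 0)) (u 0))) * b
           < inner (P (u 0)) (u 0) powr (- \<alpha>)"
    using blow(2) by (simp add: \<Phi>_def \<Psi>_def)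
  fix s assume s: "0 \<le> s" "s \<le> b"
  have "\<Psi> s \<le> \<Psi> b"
  proof (rule nondecreasing_if_derivative_nonneg[OF s(2)])
    show "(\<Psi> has_real_derivative 2 * \<Phi> x) (at x within {s..b})" if "x \<in> {s..b}" for x
      using that s by (intro DERIV_subset[OF der\<Psi>]) auto
    show "0 \<le> 2 * \<Phi> x" if "x \<in> {s..b}" for x
      using blow(1) that s by (auto simp: less_imp_le)
  qed
  then show "inner (P (u s)) (u s) \<le> inner (P (u b)) (u b)" by (simp add: \<Psi>_def)
qed

section \<open>Blow-up of maximal solutions\<close>

theorem theorem2p1:
  fixes D :: "'a::{real_inner, complete_space} set"
    and P A F :: "'a \<Rightarrow> 'a"
    and G :: "'a \<Rightarrow> real"
    and \<alpha> R0 a0 :: real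
    and u0 u1 :: 'a
    and u :: "real \<Rightarrow> 'a"
    and Tmax :: ereal
  assumes "subspace D" and "closure D = UNIV"
    and "linear_operator_on D P" and "symmetric_on D P" and "positive_definite_on D P"
    and "linear_operator_on D A" and "symmetric_on D A" and "positive_definite_on D A"
    and "continuously_differentiable_on_subspace D F"
    and "is_gradient_on D F G" and "potential_chain_rule D P A F G"
    and "\<alpha> > 0" and "R0 \<ge> 0"
    and "\<forall>v\<in>D. inner (F v) v \<ge> 2 * (1 + 2 * \<alpha>) * G v - 2 * R0"
    and "a0 > 0"
    and "\<forall>v\<in>D. inner (A v) v \<ge> a0 * inner (P v) v"
    and "u0 \<in> D" and "u1 \<in> D"
    and "inner u0 (P u1) / inner u0 (P u0) > 0"
    and "1/2 * inner u0 (A u0) + 1/2 * inner (P u1) u1 - G u0 + R0 / (1 + 2 * \<alpha>)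
           < 1/2 * ((inner u0 (P u1))\<^sup>2 / inner u0 (P u0))"
    and "local_solvability D P A F u0 u1"
    and "maximal_strong_solution D P A F u0 u1 Tmax u"
  shows "\<exists>t1>0. ereal t1 \<le> Tmax \<and>
           filterlim (\<lambda>t. inner (P (u t)) (u t)) at_top (at_left t1)"
proof -
  define K where "K = max 0 (1/2 * inner u0 (A u0) + 1/2 * inner (P u1) u1 - G u0 + R0 / (1 + 2 * \<alpha>))"
  define \<zeta> where "\<zeta> = levine \<alpha> K (inner (P u0) u1) (inner (P u0) u0)"
  define C where "C = inner (P u0) u0 powr (- \<alpha>) / (2 * \<alpha> * sqrt \<zeta>)"
  have swap: "inner u0 (P u1) = inner (P u0) u1" "inner u0 (P u0) = inner (P u0) u0"
    "inner u0 (A u0) = inner (A u0) u0"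
    using assms(4,17,18) by (simp_all add: symmetric_on_def inner_commute)
  have "0 \<le> inner (P u0) u0"
    using assms(5,17) by (cases "u0 = 0") (auto simp: positive_definite_on_def less_imp_le)
  then have init: "0 < inner (P u0) u0" "0 < inner (P u0) u1"
    using assms(19) unfolding swap by (auto simp: zero_less_divide_iff)
  have K_less: "2 * K < (inner (P u0) u1)\<^sup>2 / inner (P u0) u0"
    using assms(20) init unfolding K_def swap by (auto simp: max_def)
  have "0 < \<zeta>" using init K_less by (simp add: \<zeta>_def levine_def)
  have sol: "strong_solution_upto D P A F u0 u1 Tmax u" and max: "\<not> extendable D P A F u0 u1 Tmax u"
    using assms(22) by (auto simp: maximal_strong_solution_def)
  have bound: "(\<forall>s\<in>{0..t}. inner (P (u s)) (u s) \<le> inner (P (u t)) (u t)) \<and> t < C"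
    if t: "0 \<le> t" "ereal t < Tmax" for t
  proof -
    obtain S where S: "t < S" "ereal S < Tmax"
      using ereal_dense2[OF t(2)] by auto
    then have "strong_solution D P A F u0 u1 S u"
      using sol t by (auto simp: strong_solution_upto_def)
    then obtain u' u'' where d: "strong_solution_derivs D P A F S u u' u''" "u 0 = u0" "u' 0 = u1"
      by (auto simp: strong_solution_def)
    have FG: "2 * (1 + 2 * \<alpha>) * G v - 2 * R0 \<le> inner (F v) v" if "v \<in> D" for v
      using assms(14) that by blast
    note main = strong_solution_blow_up_bound[OF assms(1-5,7,8,11,12) FG d(1), of K t, unfolded d(2,3)]
    have "0 \<le> K" "1/2 * inner (P u1) u1 + 1/2 * inner (A u0) u0 - G u0 + R0 / (1 + 2 * \<alpha>) \<le> K"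
      unfolding K_def swap by auto
    note main' = main[OF _ this init(2,1) K_less t(1) S(1)]
    have "t * (2 * \<alpha> * sqrt \<zeta>) < inner (P u0) u0 powr (- \<alpha>)"
      using main'(2) by (simp add: \<zeta>_def mult_ac)
    then have "t < C"
      using \<open>0 < \<zeta>\<close> assms(12) unfolding C_def by (simp add: pos_less_divide_eq)
    then show ?thesis using main'(1) by auto
  qed
  have "0 < C" using init \<open>0 < \<zeta>\<close> assms(12) by (simp add: C_def)
  have "Tmax \<le> ereal C"
  proof (rule ccontr)
    assume "\<not> Tmax \<le> ereal C"
    then have "C < C" using bound[of C] \<open>0 < C\<close> by (simp add: not_le)
    then show False by simp
  qed
  moreover have "0 < Tmax" using sol by (simp add: strong_solution_upto_def)
  ultimately obtain T where T: "Tmax = ereal T" "0 < T"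
    by (cases Tmax) auto
  \<comment> \<open>Otherwise the solution could be continued beyond its finite life time \<open>T\<close>.\<close>
  have unbounded: "\<exists>t\<in>{0..<T}. M < inner (P (u t)) (u t)" for M
    using assms(21) sol max unfolding T(1) local_solvability_def by (metis not_less)
  have "filterlim (\<lambda>t. inner (P (u t)) (u t)) at_top (at_left T)"
    unfolding filterlim_at_top
  proof
    fix M
    obtain t where t: "0 \<le> t" "t < T" "M < inner (P (u t)) (u t)"
      using unbounded[of M] by auto
    have "M \<le> inner (P (u r)) (u r)" if "t < r" "r < T" for r
      using bound[of r] that t by (force simp: T(1))
    then show "eventually (\<lambda>r. M \<le> inner (P (u r)) (u r)) (at_left T)"
      using t(2) by (auto simp: eventually_at_left_field)
  qed
  then show ?thesis using T by auto
qed

end
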